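(* Let $q\in(0,1)$, $\alpha\in(-1,1)$, $\beta<1$ real, and write $p_n=p_n^{(\alpha,\beta)}(\cdot;q)$. Then for all $m,n\in\mathbb{N}_0$, \begin{align*} &\frac{2}{\pi}\int_0^{\pi}p_m(2\cos\theta)p_n(2\cos\theta)\sin^2(\theta)\left|{}_2\phi_1\!\left(e^{{\rm i}\theta}\tau,e^{{\rm i}\theta}\tau^{-1};qe^{2{\rm i}\theta};q,\alpha\right)\right|^{-2}{\rm d}\theta\\ &\quad+\sum_{0<z_k<1}\frac{z_k^2-1}{z_k^2}\frac{\psi_0^+(z_k)}{(\psi_{-1}^+)'(z_k)}\Bigl[p_m(v_k)p_n(v_k)+p_m(-v_k)p_n(-v_k)\Bigr]=\frac{(\alpha;q)_n(\alpha;q)_{n+1}}{(\beta;q)_n(\beta;q)_{n+1}}\delta_{m,n}, \end{align*} where $v_k:=z_k+z_k^{-1}$, $z_k$ runs over the zeros of $\psi_{-1}^+$ in $(0,1)$, and in the integral $\tau$ is related to $\theta$ by $\alpha(\tau+\tau^{-1})=2\beta\cos\theta$. (The sum may be empty.)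
   Context: $(a;q)_n:=\prod_{j=0}^{n-1}(1-aq^j)$, $n\in\mathbb{N}_0\cup\{\infty\}$. The monic polynomials $p_n$ satisfy $p_{-1}=0$, $p_0=1$, $p_{n+1}(x)=xp_n(x)-\tilde\gamma_{n-1}\tilde\gamma_np_{n-1}(x)$ with $\tilde\gamma_n=(1-\alpha q^n)/(1-\beta q^n)$. ${}_2\phi_1(a,b;c;q,w)=\sum_{k\ge0}\frac{(a,b;q)_k}{(c,q;q)_k}w^k$, where $\alpha^k(z\tau,z\tau^{-1};q)_k$ is understood as $c_k(z)=\prod_{j=0}^{k-1}(\alpha(1+z^2q^{2j})-\beta q^j(1+z^2))$ (so only $\alpha(\tau+\tau^{-1})=\beta(z+z^{-1})$ matters, also for $\alpha=0$). For $z\ne0$ and $n\ge-1$, $\psi_n^+(z):=z^n\sum_{k\ge0}\frac{(q^{k+1}z^2;q)_\infty}{(q;q)_k}c_k(z)q^{(n+1)k}$, an analytic function of $z\neq0$. *)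

theory Defs
  imports "HOL-Analysis.Analysis"
begin

definition qpoch :: "'a::comm_ring_1 \<Rightarrow> 'a \<Rightarrow> nat \<Rightarrow> 'a" where
  "qpoch a q n = (\<Prod>j<n. 1 - a * q ^ j)"

definition qpoch_inf :: "real \<Rightarrow> real \<Rightarrow> real" where
  "qpoch_inf a q = lim (\<lambda>n. qpoch a q n)"

definition gtil :: "real \<Rightarrow> real \<Rightarrow> real \<Rightarrow> nat \<Rightarrow> real" where
  "gtil q a b n = (1 - a * q ^ n) / (1 - b * q ^ n)"

fun P :: "real \<Rightarrow> real \<Rightarrow> real \<Rightarrow> nat \<Rightarrow> real \<Rightarrow> real" where
  "P q a b 0 x = 1"
| "P q a b (Suc 0) x = x"
| "P q a b (Suc (Suc n)) x =
     x * P q a b (Suc n) x - gtil q a b n * gtil q a b (Suc n) * P q a b n x"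

text \<open>c_k(z) = prod_(j<k) (alpha (1 + z^2 q^(2j)) - beta q^j (1 + z^2)),
  the meaning of alpha^k (z tau, z/tau; q)_k.\<close>
definition cc :: "real \<Rightarrow> real \<Rightarrow> real \<Rightarrow> nat \<Rightarrow> 'a::real_field \<Rightarrow> 'a" where
  "cc q a b k z = (\<Prod>j<k. of_real a * (1 + z\<^sup>2 * of_real q ^ (2 * j))
                          - of_real b * of_real q ^ j * (1 + z\<^sup>2))"

text \<open>2phi1(e^(i theta) tau, e^(i theta)/tau; q e^(2 i theta); q, alpha)
  with alpha^k (e^(i theta) tau, e^(i theta)/tau; q)_k read as c_k(e^(i theta)).\<close>
definition phi21 :: "real \<Rightarrow> real \<Rightarrow> real \<Rightarrow> real \<Rightarrow> complex" where
  "phi21 q a b \<theta> = (\<Sum>k. cc q a b k (cis \<theta>) /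
      (qpoch (of_real q * (cis \<theta>)\<^sup>2) (of_real q) k * qpoch (of_real q) (of_real q) k))"

definition psi :: "real \<Rightarrow> real \<Rightarrow> real \<Rightarrow> int \<Rightarrow> real \<Rightarrow> real" where
  "psi q a b n z = z powi n * (\<Sum>k. qpoch_inf (q ^ (k + 1) * z\<^sup>2) q / qpoch q q k
                                   * cc q a b k z * q powi ((n + 1) * int k))"

end

theory Submission
  imports Defs "HOL-Complex_Analysis.Complex_Analysis"
begin

text \<open>
  The functions \<open>\<psi>\<^sub>n(z)\<close> solve \<open>\<gamma>\<^sub>n (\<psi>\<^sub>n\<^sub>-\<^sub>1 + \<psi>\<^sub>n\<^sub>+\<^sub>1) = (z + 1/z) \<psi>\<^sub>n\<close> and behave like
  \<open>z\<^sup>n (q z\<^sup>2; q)\<^sub>\<infinity>\<close> as \<open>n \<rightarrow> \<infinity>\<close>, so \<open>\<psi>\<^sub>-\<^sub>1\<close> is the Jost function of the Jacobi operator of the \<open>p\<^sub>n\<close>.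
  The Casoratian of \<open>\<psi>\<^sub>n(z)\<close> and \<open>\<psi>\<^sub>n(1/z)\<close> is known from the asymptotics, which writes \<open>p\<^sub>n\<close> on the unit
  circle through \<open>\<psi>\<^sub>n(z)\<close> and \<open>\<psi>\<^sub>n(1/z)\<close> and turns the integral into the contour integral of
  \<open>p\<^sub>m(z + 1/z) (z\<^sup>2 - 1) z\<^sup>-\<^sup>2 \<psi>\<^sub>n(z) / \<psi>\<^sub>-\<^sub>1(z)\<close> over the circle. For \<open>m \<le> n\<close> the residue at \<open>0\<close> gives the
  norm and the residues at the zeros of \<open>\<psi>\<^sub>-\<^sub>1\<close> give the discrete part. These zeros are real
  and simple by the Christoffel-Darboux identity for \<open>\<psi>\<close>; on the circle only \<open>z = \<plusminus>1\<close> can be a zero, which is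
  then simple and cancelled by \<open>z\<^sup>2 - 1\<close>.
\<close>

section \<open>Jost solutions\<close>

text \<open>The Weierstrass M-test on the closed unit ball about each point gives locally uniform
  convergence. It serves both \<open>Q\<close> and the \<open>F n\<close>.\<close>

lemma entire_series:
  fixes t :: "nat \<Rightarrow> complex \<Rightarrow> complex"
  assumes hol: "\<And>k. t k holomorphic_on UNIV"
    and bound: "\<And>R. 0 \<le> R \<Longrightarrow> \<exists>M. summable M \<and> (\<forall>k z. norm z \<le> R \<longrightarrow> norm (t k z) \<le> M k)"
  shows "(\<lambda>z. \<Sum>k. t k z) holomorphic_on UNIV"
proof (rule holomorphic_uniform_sequence[where f = "\<lambda>n z. \<Sum>k<n. t k z"])
  fix z :: complex
  obtain M where M: "summable M" "\<And>k w. norm w \<le> norm z + 1 \<Longrightarrow> norm (t k w) \<le> M k"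
    using bound[of "norm z + 1"] by (auto intro: add_nonneg_nonneg)
  have "norm w \<le> norm z + 1" if "w \<in> cball z 1" for w
  proof -
    have "norm (w - z) \<le> 1" using that by (simp add: dist_norm norm_minus_commute)
    then show ?thesis using norm_triangle_sub[of w z] by linarith
  qed
  then have "uniform_limit (cball z 1) (\<lambda>n z. \<Sum>k<n. t k z) (\<lambda>z. \<Sum>k. t k z) sequentially"
    by (intro Weierstrass_m_test[OF _ M(1)] M(2))
  then show "\<exists>d>0. cball z d \<subseteq> UNIV \<and> uniform_limit (cball z d) (\<lambda>n z. \<Sum>k<n. t k z) (\<lambda>z. \<Sum>k. t k z) sequentially"
    by (intro exI[of _ 1]) auto
qed (auto intro!: holomorphic_intros hol)

text \<open>Factorwise \<open>1 + x \<le> exp x\<close> and the geometric series; what matters later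
  is that the bound does not depend on \<open>n\<close>.\<close>

lemma prod_one_plus_geometric_le:
  fixes q B :: real
  assumes "0 < q" "q < 1" "0 \<le> B"
  shows "(\<Prod>j<n. 1 + B * q ^ j) \<le> exp (B / (1 - q))"
proof -
  have "(\<Prod>j<n. 1 + B * q ^ j) \<le> (\<Prod>j<n. exp (B * q ^ j))"
    using assms by (intro prod_mono) (auto intro!: add_nonneg_nonneg)
  also have "\<dots> = exp (\<Sum>j<n. B * q ^ j)"
    by (simp add: exp_sum)
  also have "(\<Sum>j<n. B * q ^ j) = B * (\<Sum>j<n. q ^ j)"
    by (simp add: sum_distrib_left)
  also have "(\<Sum>j<n. q ^ j) \<le> (\<Sum>j. q ^ j)"
    using assms by (intro sum_le_suminf summable_geometric) auto
  also have "(\<Sum>j. q ^ j) = 1 / (1 - q)"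
    using assms by (intro suminf_geometric) auto
  finally show ?thesis using assms by (simp add: mult_left_mono)
qed

lemma qpoch_Suc: "qpoch a q (Suc n) = qpoch a q n * (1 - a * q ^ n)"
  by (simp add: qpoch_def)

lemma qpoch_Suc_shift: "qpoch a q (Suc n) = (1 - a) * qpoch (a * q) q n"
  unfolding qpoch_def prod.lessThan_Suc_shift by (simp add: mult.assoc)

lemma of_real_qpoch: "of_real (qpoch a q n) = qpoch (of_real a) (of_real q :: 'a :: {real_algebra_1, comm_ring_1}) n"
  by (simp add: qpoch_def)

locale parameters =
  fixes q \<alpha> \<beta> :: real
  assumes q: "0 < q" "q < 1" and \<alpha>: "-1 < \<alpha>" "\<alpha> < 1" and \<beta>: "\<beta> < 1"
begin

section \<open>The infinite q-shifted factorial as an entire function\<close>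

abbreviation cq :: complex where "cq \<equiv> of_real q"

text \<open>The complex counterpart of \<open>qpoch_inf\<close>, so that holomorphy can be used;
  \<open>of_real_qpoch_inf\<close> links the two.\<close>

definition Q :: "complex \<Rightarrow> complex" where
  "Q u = lim (\<lambda>n. qpoch u cq n)"

lemma norm_qpoch_le: "norm (qpoch u cq n) \<le> exp (norm u / (1 - q))"
proof -
  have "norm (qpoch u cq n) = (\<Prod>j<n. norm (1 - u * cq ^ j))"
    by (simp add: qpoch_def prod_norm)
  also have "\<dots> \<le> (\<Prod>j<n. 1 + norm u * q ^ j)"
    using q by (intro prod_mono conjI order.trans[OF norm_triangle_ineq4])
      (auto simp: norm_mult norm_power)
  also have "\<dots> \<le> exp (norm u / (1 - q))"
    using q by (intro prod_one_plus_geometric_le) auto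
  finally show ?thesis .
qed

lemma norm_qpoch_increment_le:
  assumes "norm u \<le> R"
  shows "norm (- u * cq ^ k * qpoch u cq k) \<le> R * exp (R / (1 - q)) * q ^ k"
proof -
  have "norm (- u * cq ^ k * qpoch u cq k) = norm u * norm (qpoch u cq k) * q ^ k"
    using q by (simp add: norm_mult norm_power)
  also have "\<dots> \<le> R * exp (R / (1 - q)) * q ^ k"
    using q assms order.trans[OF norm_ge_zero assms]
    by (intro mult_right_mono mult_mono order.trans[OF norm_qpoch_le]) (auto simp: divide_right_mono)
  finally show ?thesis .
qed

lemma summable_qpoch_increment: "summable (\<lambda>k. - u * cq ^ k * qpoch u cq k)"
proof (rule summable_comparison_test'[where N = 0])
  show "summable (\<lambda>k. norm u * exp (norm u / (1 - q)) * q ^ k)"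
    using q by (intro summable_mult summable_geometric) auto
qed (rule norm_qpoch_increment_le, simp)

text \<open>Telescoping: passing from \<open>n\<close> to \<open>n + 1\<close> factors adds
  \<open>- u * cq ^ n * qpoch u cq n\<close>. Writing the infinite product as a series makes
  \<open>entire_series\<close> applicable.\<close>

lemma qpoch_tendsto_series: "(\<lambda>n. qpoch u cq n) \<longlonglongrightarrow> 1 + (\<Sum>k. - u * cq ^ k * qpoch u cq k)"
proof -
  have eq: "qpoch u cq n = 1 + (\<Sum>k<n. - u * cq ^ k * qpoch u cq k)" for n
  proof (induction n)
    case (Suc n)
    have "qpoch u cq (Suc n) = qpoch u cq n + - u * cq ^ n * qpoch u cq n"
      by (simp add: qpoch_Suc algebra_simps)
    also have "\<dots> = 1 + (\<Sum>k<Suc n. - u * cq ^ k * qpoch u cq k)"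
      unfolding sum.lessThan_Suc by (subst (1) Suc) (simp only: add.assoc)
    finally show ?case .
  qed (simp add: qpoch_def)
  have "(\<lambda>n. 1 + (\<Sum>k<n. - u * cq ^ k * qpoch u cq k)) \<longlonglongrightarrow> 1 + (\<Sum>k. - u * cq ^ k * qpoch u cq k)"
    by (intro tendsto_add tendsto_const summable_LIMSEQ summable_qpoch_increment)
  then show ?thesis by (rule Lim_transform_eventually) (intro always_eventually allI eq[symmetric])
qed

lemma Q_series: "Q u = 1 + (\<Sum>k. - u * cq ^ k * qpoch u cq k)"
  unfolding Q_def by (intro limI qpoch_tendsto_series)

lemma qpoch_tendsto_Q: "(\<lambda>n. qpoch u cq n) \<longlonglongrightarrow> Q u"
  unfolding Q_series by (rule qpoch_tendsto_series)

lemma Q_0: "Q 0 = 1"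
  by (simp add: Q_series)

lemma Q_holomorphic: "Q holomorphic_on UNIV"
proof -
  have "(\<lambda>u. \<Sum>k. - u * cq ^ k * qpoch u cq k) holomorphic_on UNIV"
  proof (rule entire_series)
    fix R :: real assume "0 \<le> R"
    have "summable (\<lambda>k. R * exp (R / (1 - q)) * q ^ k)"
      using q by (intro summable_mult summable_geometric) auto
    then show "\<exists>M. summable M \<and> (\<forall>k z. norm z \<le> R \<longrightarrow> norm (- z * cq ^ k * qpoch z cq k) \<le> M k)"
      using norm_qpoch_increment_le by blast
  qed (auto simp: qpoch_def intro!: holomorphic_intros)
  then have "(\<lambda>u. 1 + (\<Sum>k. - u * cq ^ k * qpoch u cq k)) holomorphic_on UNIV"
    by (intro holomorphic_intros)
  then show ?thesis
    by (simp add: Q_series[abs_def])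
qed

lemma norm_Q_le: "norm (Q u) \<le> exp (norm u / (1 - q))"
  by (rule Lim_bounded[OF tendsto_norm[OF qpoch_tendsto_Q], where M = 0]) (auto intro: norm_qpoch_le)

lemma Q_step: "Q u = (1 - u) * Q (u * cq)"
proof -
  have "(\<lambda>n. qpoch u cq (Suc n)) \<longlonglongrightarrow> (1 - u) * Q (u * cq)"
    unfolding qpoch_Suc_shift by (intro tendsto_mult tendsto_const qpoch_tendsto_Q)
  then show ?thesis
    using LIMSEQ_unique[OF LIMSEQ_Suc[OF qpoch_tendsto_Q]] by blast
qed

lemma Q_split: "Q u = qpoch u cq k * Q (u * cq ^ k)"
proof (induction k)
  case (Suc k)
  have "Q u = qpoch u cq k * ((1 - u * cq ^ k) * Q (u * cq ^ k * cq))"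
    by (subst Suc, subst Q_step) (rule refl)
  then show ?case by (simp only: qpoch_Suc power_Suc2 mult.assoc)
qed (simp add: qpoch_def)

text \<open>The product converges absolutely and each factor is nonzero because
  \<open>u * cq ^ i\<close> stays inside the unit disc.\<close>

lemma Q_nonzero:
  assumes "norm u < 1"
  shows "Q u \<noteq> 0"
proof -
  let ?f = "\<lambda>i. 1 - u * cq ^ i"
  have "summable (\<lambda>i. norm u * q ^ i)"
    using q by (intro summable_mult summable_geometric) auto
  then have "summable (\<lambda>i. norm (?f i - 1))"
    using q by (simp add: norm_mult norm_power)
  then have conv: "convergent_prod ?f"
    by (intro abs_convergent_prod_imp_convergent_prod summable_imp_abs_convergent_prod)
  have "?f i \<noteq> 0" for i
  proof
    assume "?f i = 0"
    then have "norm (u * cq ^ i) = 1" by (metis eq_iff_diff_eq_0 norm_one)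
    moreover have "norm (u * cq ^ i) < 1 * 1"
      unfolding norm_mult norm_power using q assms
      by (intro mult_less_le_imp_less) (auto simp: power_le_one)
    ultimately show False by simp
  qed
  then have "prodinf ?f \<noteq> 0" using conv by (intro prodinf_nonzero) auto
  moreover have "(\<lambda>n. qpoch u cq (Suc n)) \<longlonglongrightarrow> prodinf ?f"
    using convergent_prod_LIMSEQ[OF conv] by (simp add: qpoch_def lessThan_Suc_atMost)
  ultimately show ?thesis
    using LIMSEQ_unique[OF LIMSEQ_Suc[OF qpoch_tendsto_Q]] by metis
qed

lemma qpoch_nonzero: "norm u < 1 \<Longrightarrow> qpoch u cq k \<noteq> 0"
  using Q_split[of u k] Q_nonzero[of u] by auto

lemma cnj_qpoch: "cnj (qpoch u cq n) = qpoch (cnj u) cq n"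
  by (simp add: qpoch_def)

lemma cnj_Q: "cnj (Q u) = Q (cnj u)"
proof -
  have "(\<lambda>n. qpoch (cnj u) cq n) \<longlonglongrightarrow> cnj (Q u)"
    using tendsto_cnj[OF qpoch_tendsto_Q] by (simp add: cnj_qpoch)
  then show ?thesis using LIMSEQ_unique qpoch_tendsto_Q by blast
qed

lemma of_real_qpoch_inf: "of_real (qpoch_inf a q) = Q (of_real a)"
proof -
  have "(\<lambda>n. qpoch a q n) \<longlonglongrightarrow> Re (Q (of_real a))"
    using tendsto_Re[OF qpoch_tendsto_Q[of "of_real a"]] by (simp flip: of_real_qpoch)
  then have "qpoch_inf a q = Re (Q (of_real a))"
    unfolding qpoch_inf_def by (rule limI)
  moreover have "cnj (Q (of_real a)) = Q (of_real a)" by (simp add: cnj_Q)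
  ultimately show ?thesis by (simp add: complex_eq_iff)
qed

section \<open>Bounds, analyticity and asymptotics of the Jost solutions\<close>

lemma inverse_qpoch_bounded: obtains C where "C > 0" "\<And>k. norm (inverse (qpoch cq cq k)) \<le> C"
proof -
  have "(\<lambda>k. inverse (qpoch cq cq k)) \<longlonglongrightarrow> inverse (Q cq)"
    using q by (intro tendsto_inverse qpoch_tendsto_Q Q_nonzero) auto
  then have "Bseq (\<lambda>k. inverse (qpoch cq cq k))"
    using convergent_imp_Bseq convergentI by blast
  then show ?thesis using that unfolding Bseq_def by blast
qed

text \<open>The factors of \<open>cc\<close> differ from \<alpha> by terms of order
  \<open>q ^ j\<close>. Taking \<open>r\<close> midway between \<open>\<bar>\<alpha>\<bar>\<close>
  and 1 keeps it positive even for \<alpha> = 0; the corrections \<open>1 + B / r * q ^ j\<close>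
  have bounded products, so geometric decay in \<open>k\<close> remains.\<close>

lemma norm_cc_le:
  defines "r \<equiv> (1 + \<bar>\<alpha>\<bar>) / 2"
  assumes "norm (z::complex) \<le> R"
  shows "norm (cc q \<alpha> \<beta> k z) \<le> exp ((\<bar>\<alpha>\<bar> * R\<^sup>2 + \<bar>\<beta>\<bar> * (1 + R\<^sup>2)) / r / (1 - q)) * r ^ k"
proof -
  define B where "B = \<bar>\<alpha>\<bar> * R\<^sup>2 + \<bar>\<beta>\<bar> * (1 + R\<^sup>2)"
  have r: "r > 0" "\<bar>\<alpha>\<bar> \<le> r" using \<alpha> by (auto simp: r_def)
  have B: "B \<ge> 0" by (simp add: B_def)
  have z2: "norm (z\<^sup>2) \<le> R\<^sup>2"
    using assms by (simp add: norm_power power_mono)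
  have fac: "norm (of_real \<alpha> * (1 + z\<^sup>2 * cq ^ (2 * j)) - of_real \<beta> * cq ^ j * (1 + z\<^sup>2)) \<le> r * (1 + B / r * q ^ j)" for j
  proof -
    have "norm (z\<^sup>2 * cq ^ (2 * j)) \<le> R\<^sup>2 * q ^ j"
    proof -
      have "q ^ (2 * j) \<le> q ^ j" using q by (intro power_decreasing) auto
      then show ?thesis using z2 q by (simp add: norm_mult norm_power mult_mono)
    qed
    then have 1: "norm (1 + z\<^sup>2 * cq ^ (2 * j)) \<le> 1 + R\<^sup>2 * q ^ j"
      using norm_triangle_ineq[of 1 "z\<^sup>2 * cq ^ (2 * j)"] by simp
    have 2: "norm (1 + z\<^sup>2) \<le> 1 + R\<^sup>2"
      using norm_triangle_ineq[of 1 "z\<^sup>2"] z2 by simp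
    have "norm (of_real \<alpha> * (1 + z\<^sup>2 * cq ^ (2 * j)) - of_real \<beta> * cq ^ j * (1 + z\<^sup>2))
        \<le> \<bar>\<alpha>\<bar> * (1 + R\<^sup>2 * q ^ j) + \<bar>\<beta>\<bar> * q ^ j * (1 + R\<^sup>2)"
      using 1 2 q by (intro order.trans[OF norm_triangle_ineq4] add_mono)
        (auto simp: norm_mult norm_power intro!: mult_mono)
    also have "\<dots> = \<bar>\<alpha>\<bar> + B * q ^ j" by (simp add: B_def algebra_simps)
    also have "\<dots> \<le> r * (1 + B / r * q ^ j)" using r by (simp add: field_simps)
    finally show ?thesis .
  qed
  have "norm (cc q \<alpha> \<beta> k z) \<le> (\<Prod>j<k. r * (1 + B / r * q ^ j))"
    unfolding cc_def prod_norm[symmetric] using fac by (intro prod_mono) auto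
  also have "\<dots> = r ^ k * (\<Prod>j<k. 1 + B / r * q ^ j)"
    by (simp add: prod.distrib)
  also have "\<dots> \<le> r ^ k * exp (B / r / (1 - q))"
    using r B q by (intro mult_left_mono prod_one_plus_geometric_le) auto
  finally show ?thesis by (simp add: B_def mult_ac)
qed

definition A :: "nat \<Rightarrow> complex \<Rightarrow> complex" where
  "A k z = Q (cq ^ (k + 1) * z\<^sup>2) / qpoch cq cq k * cc q \<alpha> \<beta> k z"

text \<open>The paper's \<open>\<psi>\<^sub>n\<^sub>-\<^sub>1(z)\<close> is \<open>z\<^sup>n\<^sup>-\<^sup>1 F n z\<close>; the shift keeps all indices natural.\<close>
definition F :: "nat \<Rightarrow> complex \<Rightarrow> complex" where
  "F n z = (\<Sum>k. A k z * cq ^ (n * k))"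

lemma norm_A_le:
  obtains C r where "C > 0" "0 < r" "r < 1" "\<And>k z. norm z \<le> R \<Longrightarrow> norm (A k z) \<le> C * r ^ k"
proof -
  define r where "r = (1 + \<bar>\<alpha>\<bar>) / 2"
  obtain D where D: "D > 0" "\<And>k. norm (inverse (qpoch cq cq k)) \<le> D" using inverse_qpoch_bounded by blast
  define E where "E = exp ((\<bar>\<alpha>\<bar> * R\<^sup>2 + \<bar>\<beta>\<bar> * (1 + R\<^sup>2)) / r / (1 - q))"
  have "norm (A k z) \<le> (exp (R\<^sup>2 / (1 - q)) * D * E) * r ^ k" if z: "norm z \<le> R" for k z
  proof -
    have z2: "norm (z\<^sup>2) \<le> R\<^sup>2" using z by (simp add: norm_power power_mono)
    have "norm (cq ^ (k + 1) * z\<^sup>2) \<le> 1 * R\<^sup>2"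
      unfolding norm_mult norm_power[of cq] using z2 q by (intro mult_mono) (auto simp: power_le_one mult_le_one)
    then have "norm (Q (cq ^ (k + 1) * z\<^sup>2)) \<le> exp (R\<^sup>2 / (1 - q))"
      using q by (intro order.trans[OF norm_Q_le]) (simp add: divide_right_mono)
    moreover have "norm (cc q \<alpha> \<beta> k z) \<le> E * r ^ k"
      unfolding E_def r_def by (rule norm_cc_le[OF z])
    ultimately show ?thesis
      unfolding A_def divide_inverse norm_mult mult.assoc[of _ E]
      using D by (intro mult_mono) auto
  qed
  moreover have "exp (R\<^sup>2 / (1 - q)) * D * E > 0" using D by (simp add: E_def)
  moreover have "0 < r" "r < 1" using \<alpha> by (auto simp: r_def)
  ultimately show ?thesis using that by blast
qed

text \<open>The first bound keeps the decay in \<open>n\<close> and yields the limit of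
  \<open>F n z\<close>; the second is uniform in \<open>n\<close> and yields summability and
  boundedness.\<close>

lemma norm_F_term_le:
  obtains C r where "C > 0" "0 < r" "r < 1"
    "\<And>k z n. norm z \<le> R \<Longrightarrow> norm (A k z * cq ^ (n * k)) \<le> C * r ^ k * (q ^ n) ^ k"
    "\<And>k z n. norm z \<le> R \<Longrightarrow> norm (A k z * cq ^ (n * k)) \<le> C * r ^ k"
proof -
  obtain C r where C: "C > 0" "0 < r" "r < 1" "\<And>k z. norm z \<le> R \<Longrightarrow> norm (A k z) \<le> C * r ^ k"
    using norm_A_le by blast
  have 1: "norm (A k z * cq ^ (n * k)) \<le> C * r ^ k * (q ^ n) ^ k" if "norm z \<le> R" for k z n
    unfolding norm_mult norm_power power_mult[symmetric] using q C(1,2) C(4)[OF that]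
    by (intro mult_mono) auto
  have 2: "norm (A k z * cq ^ (n * k)) \<le> C * r ^ k" if "norm z \<le> R" for k z n
  proof -
    have "C * r ^ k * (q ^ n) ^ k \<le> C * r ^ k * 1"
      using C q by (intro mult_left_mono) (auto simp: power_le_one)
    then show ?thesis using 1[OF that, of k n] by simp
  qed
  show ?thesis using that C(1-3) 1 2 by blast
qed

lemma summable_F: "summable (\<lambda>k. A k z * cq ^ (n * k))"
proof -
  obtain C r where C: "C > 0" "0 < r" "r < 1"
    "\<And>k w n. norm w \<le> norm z \<Longrightarrow> norm (A k w * cq ^ (n * k)) \<le> C * r ^ k"
    using norm_F_term_le[of "norm z"] by metis
  show ?thesis
    by (rule summable_comparison_test'[where g = "\<lambda>k. C * r ^ k" and N = 0])
      (use C in \<open>auto intro!: summable_mult summable_geometric\<close>)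
qed

lemma A_holomorphic: "A k holomorphic_on UNIV"
proof -
  have "(Q \<circ> (\<lambda>z. cq ^ (k + 1) * z\<^sup>2)) holomorphic_on UNIV"
    by (intro holomorphic_on_compose_gen[where t = UNIV] Q_holomorphic holomorphic_intros) auto
  then show ?thesis
    unfolding A_def[abs_def] cc_def o_def using q qpoch_nonzero[of cq k]
    by (intro holomorphic_intros) auto
qed

lemma F_holomorphic_UNIV: "F n holomorphic_on UNIV"
  unfolding F_def[abs_def]
proof (rule entire_series)
  fix R :: real
  obtain C r where C: "C > 0" "0 < r" "r < 1"
    "\<And>k w n. norm w \<le> R \<Longrightarrow> norm (A k w * cq ^ (n * k)) \<le> C * r ^ k"
    using norm_F_term_le[of R] by metis
  then show "\<exists>M. summable M \<and> (\<forall>k z. norm z \<le> R \<longrightarrow> norm (A k z * cq ^ (n * k)) \<le> M k)"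
    by (intro exI[of _ "\<lambda>k. C * r ^ k"]) (auto intro!: summable_mult summable_geometric)
qed (auto intro!: holomorphic_intros A_holomorphic)

lemma F_holomorphic [holomorphic_intros]: "F n holomorphic_on S"
  using F_holomorphic_UNIV holomorphic_on_subset by blast

lemma F_bounded: obtains C where "C > 0" "\<And>n z. norm z \<le> R \<Longrightarrow> norm (F n z) \<le> C"
proof -
  obtain C r where C: "C > 0" "0 < r" "r < 1"
    "\<And>k w n. norm w \<le> R \<Longrightarrow> norm (A k w * cq ^ (n * k)) \<le> C * r ^ k"
    using norm_F_term_le[of R] by metis
  have sm: "summable (\<lambda>k. C * r ^ k)" using C by (intro summable_mult summable_geometric) auto
  have "norm (F n z) \<le> C * (1 / (1 - r))" if "norm z \<le> R" for n z
  proof -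
    have "norm (F n z) \<le> (\<Sum>k. C * r ^ k)"
      unfolding F_def using C(4)[OF that] sm by (rule norm_suminf_le)
    also have "\<dots> = C * (1 / (1 - r))"
      using C by (subst suminf_mult) (auto simp: suminf_geometric)
    finally show ?thesis .
  qed
  moreover have "C * (1 / (1 - r)) > 0" using C(1-3) by simp
  ultimately show ?thesis using that by blast
qed

text \<open>Only the term \<open>k = 0\<close> survives as \<open>n\<close> grows, since the tail is
  of order \<open>q ^ n\<close>.\<close>

lemma F_tendsto: "(\<lambda>n. F n z) \<longlonglongrightarrow> Q (cq * z\<^sup>2)"
proof -
  obtain C r where C: "C > 0" "0 < r" "r < 1"
    "\<And>k w n. norm w \<le> norm z \<Longrightarrow> norm (A k w * cq ^ (n * k)) \<le> C * r ^ k * (q ^ n) ^ k"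
    using norm_F_term_le[of "norm z"] by metis
  have sm: "summable (\<lambda>k. C * r * q ^ n * r ^ k)" for n
    using C by (intro summable_mult summable_geometric) auto
  have bound: "norm (F n z - Q (cq * z\<^sup>2)) \<le> C * r * q ^ n * (1 / (1 - r))" for n
  proof -
    have "F n z - A 0 z = (\<Sum>k. A (Suc k) z * cq ^ (n * Suc k))"
      unfolding F_def using suminf_split_head[OF summable_F[of z n]] by simp
    also have "norm \<dots> \<le> (\<Sum>k. C * r * q ^ n * r ^ k)"
    proof (rule norm_suminf_le[OF _ sm])
      fix k
      have "norm (A (Suc k) z * cq ^ (n * Suc k)) \<le> C * r ^ Suc k * (q ^ n) ^ Suc k"
        using C(4) by blast
      also have "\<dots> = (C * r * q ^ n * r ^ k) * (q ^ n) ^ k" by simp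
      also have "\<dots> \<le> (C * r * q ^ n * r ^ k) * 1"
        using C q by (intro mult_left_mono) (auto simp: power_le_one)
      finally show "norm (A (Suc k) z * cq ^ (n * Suc k)) \<le> C * r * q ^ n * r ^ k" by simp
    qed
    also have "\<dots> = C * r * q ^ n * (1 / (1 - r))"
      using C by (subst suminf_mult) (auto simp: suminf_geometric)
    also have "A 0 z = Q (cq * z\<^sup>2)" by (simp add: A_def qpoch_def cc_def)
    finally show ?thesis .
  qed
  have "(\<lambda>n. C * r * q ^ n * (1 / (1 - r))) \<longlonglongrightarrow> C * r * 0 * (1 / (1 - r))"
    using q by (intro tendsto_mult tendsto_const LIMSEQ_power_zero) auto
  then have "(\<lambda>n. C * r * q ^ n * (1 / (1 - r))) \<longlonglongrightarrow> 0" by simp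
  then have "(\<lambda>n. F n z - Q (cq * z\<^sup>2)) \<longlonglongrightarrow> 0"
    by (rule Lim_null_comparison[rotated]) (intro always_eventually allI bound)
  then show ?thesis by (rule LIM_zero_cancel)
qed

section \<open>The three-term recurrence of the Jost solutions\<close>

lemma A_Suc:
  "A (Suc k) z * (1 - cq ^ Suc k) * (1 - cq ^ Suc k * z\<^sup>2) =
    A k z * (of_real \<alpha> * (1 + z\<^sup>2 * cq ^ (2 * k)) - of_real \<beta> * cq ^ k * (1 + z\<^sup>2))"
proof -
  define f :: complex where "f = of_real \<alpha> * (1 + z\<^sup>2 * cq ^ (2 * k)) - of_real \<beta> * cq ^ k * (1 + z\<^sup>2)"
  have "qpoch cq cq (Suc k) \<noteq> 0" using q by (intro qpoch_nonzero) auto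
  then have nz: "qpoch cq cq k \<noteq> 0" "1 - cq ^ Suc k \<noteq> 0" by (auto simp: qpoch_Suc)
  have Q: "Q (cq ^ (k + 1) * z\<^sup>2) = (1 - cq ^ Suc k * z\<^sup>2) * Q (cq ^ (Suc k + 1) * z\<^sup>2)"
    by (subst Q_step) (simp add: mult_ac)
  have qp: "qpoch cq cq (Suc k) = qpoch cq cq k * (1 - cq ^ Suc k)" by (simp add: qpoch_Suc)
  have cc: "cc q \<alpha> \<beta> (Suc k) z = cc q \<alpha> \<beta> k z * f" by (simp add: cc_def f_def)
  have *: "X / (p * g) * (c * f) * g * h = (h * X) / p * c * f"
    if "g \<noteq> 0" for X p g h c f :: complex
    using that by simp
  show ?thesis
    unfolding A_def cc qp f_def[symmetric] Q by (rule *[OF nz(2)])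
qed

text \<open>In \<open>F n z - (1 + z^2) F (n + 1) z + z^2 F (n + 2) z\<close> the
  \<open>k\<close>-th term is \<open>A k z * cq ^ (n * k)\<close> times
  \<open>(1 - cq ^ k) (1 - cq ^ k * z^2)\<close>. By \<open>A_Suc\<close> a shift of
  \<open>k\<close> by one turns this series into the one with \<alpha> and \<beta>.\<close>

lemma F_recurrence:
  "of_real (1 - \<alpha> * q ^ n) * (F n z + z\<^sup>2 * F (n + 2) z) = of_real (1 - \<beta> * q ^ n) * (1 + z\<^sup>2) * F (n + 1) z"
proof -
  let ?t = "\<lambda>n k. A k z * cq ^ (n * k)"
  have S: "(\<lambda>k. ?t n k) sums F n z" for n unfolding F_def by (intro summable_sums summable_F)
  have L: "(\<lambda>k. ?t n k - (1 + z\<^sup>2) * ?t (n + 1) k + z\<^sup>2 * ?t (n + 2) k) sums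
     (F n z - (1 + z\<^sup>2) * F (n + 1) z + z\<^sup>2 * F (n + 2) z)" (is "?l sums ?L")
    by (intro sums_add sums_diff sums_mult S)
  have R: "(\<lambda>k. cq ^ n * (of_real \<alpha> * (?t n k + z\<^sup>2 * ?t (n + 2) k) - of_real \<beta> * (1 + z\<^sup>2) * ?t (n + 1) k)) sums
     (cq ^ n * (of_real \<alpha> * (F n z + z\<^sup>2 * F (n + 2) z) - of_real \<beta> * (1 + z\<^sup>2) * F (n + 1) z))" (is "?r sums ?R")
    by (intro sums_add sums_diff sums_mult S)
  have "?l (Suc k) = ?r k" for k
  proof -
    have pow: "cq ^ ((n + 1) * k) = cq ^ (n * k) * cq ^ k" "cq ^ ((n + 2) * k) = cq ^ (n * k) * cq ^ k * cq ^ k" for k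
      by (simp_all add: power_add[symmetric] algebra_simps)
    have pow2: "cq ^ (2 * k) = cq ^ k * cq ^ k" "cq ^ (n * Suc k) = cq ^ n * cq ^ (n * k)"
      by (simp_all add: power_add[symmetric] mult_2)
    have "?l (Suc k) = A (Suc k) z * (1 - cq ^ Suc k) * (1 - cq ^ Suc k * z\<^sup>2) * cq ^ (n * Suc k)"
      unfolding pow by (simp only: algebra_simps mult_1_left)
    also have "\<dots> = ?r k"
      unfolding A_Suc pow pow2 by (simp only: algebra_simps mult_1_left)
    finally show ?thesis .
  qed
  \<comment> \<open>The factor \<open>1 - cq ^ k\<close> vanishes at \<open>k = 0\<close>, so the
    index shift loses nothing.\<close>
  moreover have "?l 0 = 0" by (simp add: algebra_simps)
  ultimately have "?r sums ?L" using L sums_Suc_iff[of ?l ?L] by simp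
  then have "?L = ?R" using R by (rule sums_unique2)
  then show ?thesis by (simp add: algebra_simps)
qed

lemma cnj_F: "cnj (F n z) = F n (cnj z)"
proof -
  have eq: "cnj (A k z * cq ^ (n * k)) = A k (cnj z) * cq ^ (n * k)" for k
    by (simp add: A_def cnj_Q cnj_qpoch cc_def)
  have "(\<lambda>k. cnj (A k z * cq ^ (n * k))) sums cnj (F n z)"
    unfolding F_def by (subst sums_cnj) (intro summable_sums summable_F)
  then have "(\<lambda>k. A k (cnj z) * cq ^ (n * k)) sums cnj (F n z)" by (simp only: eq)
  then show ?thesis unfolding F_def by (rule sums_unique)
qed

lemma F_even: "F n (- z) = F n z"
  by (simp add: F_def A_def cc_def)

end

section \<open>Casoratians and zeros\<close>

text \<open>From \<open>N = k + 1\<close> on the partial sums are at least \<open>t k\<close>, so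
  \<open>norm c * t k\<close> is bounded by a null sequence. Applied with the sums in the
  Christoffel-Darboux identity.\<close>

lemma zero_if_positive_sums_vanish:
  fixes c :: "'a::real_normed_field" and t :: "nat \<Rightarrow> real"
  assumes eq: "\<And>N. c * of_real (\<Sum>n<N. t n) = e N" and e: "e \<longlonglongrightarrow> 0"
    and t: "\<And>n. t n \<ge> 0" and pos: "t k > 0"
  shows "c = 0"
proof (rule ccontr)
  assume "c \<noteq> 0"
  have "norm c * t k \<le> norm (e N)" if "N \<ge> Suc k" for N
  proof -
    have "t k \<le> (\<Sum>n<N. t n)" using that t by (intro member_le_sum) auto
    then have "norm c * t k \<le> norm c * \<bar>\<Sum>n<N. t n\<bar>" by (intro mult_left_mono) auto
    also have "\<dots> = norm (e N)" using eq[of N] by (metis norm_mult norm_of_real)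
    finally show ?thesis .
  qed
  then have "norm c * t k \<le> 0"
    using e by (intro Lim_bounded2[where f = "\<lambda>N. norm (e N)" and N = "Suc k"]) (auto simp: tendsto_norm_zero)
  then show False using pos \<open>c \<noteq> 0\<close> by (simp add: mult_le_0_iff)
qed

context parameters
begin

section \<open>Recurrence coefficients and the value at the origin\<close>

abbreviation \<gamma> :: "nat \<Rightarrow> real" where "\<gamma> \<equiv> gtil q \<alpha> \<beta>"

lemma one_minus_pos: "x < 1 \<Longrightarrow> 1 - x * q ^ n > 0"
proof -
  assume "x < 1"
  have "q ^ n \<le> 1" "0 < q ^ n" using q by (auto simp: power_le_one)
  then have "x * q ^ n < 1"
    using \<open>x < 1\<close> mult_strict_right_mono[of x 1 "q ^ n"] by linarith
  then show ?thesis by simp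
qed

lemma \<gamma>_pos: "\<gamma> n > 0"
  using one_minus_pos \<alpha> \<beta> by (simp add: gtil_def)

text \<open>The factor that rescales a solution of the Jost recurrence to the monic polynomials; the
  squared norms turn out to be \<open>G n * G (n + 1)\<close>.\<close>

definition G :: "nat \<Rightarrow> real" where "G n = (\<Prod>j<n. \<gamma> j)"

lemma G_Suc: "G (Suc n) = G n * \<gamma> n" and G_0: "G 0 = 1"
  by (simp_all add: G_def)

lemma G_eq_qpoch: "G n = qpoch \<alpha> q n / qpoch \<beta> q n"
  by (simp add: G_def gtil_def qpoch_def prod_dividef)

lemma F_recurrence_\<gamma>: "of_real (\<gamma> n) * (F n z + z\<^sup>2 * F (n + 2) z) = (1 + z\<^sup>2) * F (n + 1) z"
proof -
  have "of_real (1 - \<beta> * q ^ n) \<noteq> (0::complex)" "of_real (\<gamma> n) = of_real (1 - \<alpha> * q ^ n) / (of_real (1 - \<beta> * q ^ n) :: complex)"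
    using one_minus_pos[OF \<beta>, of n] by (simp_all only: gtil_def of_real_divide of_real_eq_0_iff)
  then show ?thesis using F_recurrence[of n z]
    by (simp only: times_divide_eq_left mult.assoc nonzero_mult_div_cancel_left not_False_eq_True)
qed

lemma F_at_0: "F n 0 = of_real (G n) * F 0 0"
proof (induction n)
  case (Suc n)
  show ?case using F_recurrence_\<gamma>[of n 0] Suc by (simp add: G_Suc mult_ac)
qed (simp add: G_0)

text \<open>Otherwise \<open>F_at_0\<close> makes every \<open>F n 0\<close> vanish, contradicting
  the limit \<open>Q 0 = 1\<close>.\<close>

lemma F_0_0_nonzero: "F 0 0 \<noteq> 0"
proof
  assume "F 0 0 = 0"
  then have "F n 0 = 0" for n by (subst F_at_0) simp
  then have "(\<lambda>n. 0) \<longlonglongrightarrow> Q (cq * 0\<^sup>2)" using F_tendsto[of 0] by (simp only:)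
  then show False using LIMSEQ_unique[OF tendsto_const] Q_0 by fastforce
qed

text \<open>This is \<open>z\<close> times the Jost solution of index \<open>n - 1\<close>: the
  extra \<open>z\<close> makes it entire and does not affect the recurrence.\<close>

definition s :: "nat \<Rightarrow> complex \<Rightarrow> complex" where "s n z = z ^ n * F n z"

lemma s_recurrence:
  assumes "z \<noteq> 0"
  shows "of_real (\<gamma> n) * (s n z + s (n + 2) z) = (z + 1 / z) * s (n + 1) z"
proof -
  have "of_real (\<gamma> n) * (s n z + s (n + 2) z) = z ^ n * (of_real (\<gamma> n) * (F n z + z\<^sup>2 * F (n + 2) z))"
    by (simp add: s_def algebra_simps power2_eq_square)
  also have "\<dots> = (z + 1 / z) * s (n + 1) z"
    unfolding F_recurrence_\<gamma> using assms by (simp add: s_def field_simps power2_eq_square)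
  finally show ?thesis .
qed

lemma cnj_s: "cnj (s n z) = s n (cnj z)"
  by (simp add: s_def cnj_F)

lemma s_holomorphic [holomorphic_intros]: "s n holomorphic_on S"
  unfolding s_def[abs_def] by (intro holomorphic_intros)

section \<open>Casoratians and the Christoffel-Darboux identity\<close>

definition casoratian :: "nat \<Rightarrow> complex \<Rightarrow> complex \<Rightarrow> complex" where
  "casoratian n a w = s n a * s (n + 1) w - s (n + 1) a * s n w"

text \<open>Dividing the recurrence by \<open>\<gamma> n\<close> makes it symmetric, so each summand
  is a difference of consecutive Casoratians. Three uses follow: \<open>w = 1 / a\<close> makes the
  Casoratian constant, \<open>w = cnj a\<close> gives reality of the zeros, and the derivative at
  \<open>w = a\<close> gives their simplicity.\<close>

lemma Christoffel_Darboux: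
  assumes "a \<noteq> 0" "w \<noteq> 0"
  shows "((a + 1 / a) - (w + 1 / w)) * (\<Sum>n<N. s (n + 1) a * s (n + 1) w / of_real (\<gamma> n)) = casoratian 0 a w - casoratian N a w"
proof (induction N)
  case (Suc n)
  have g: "of_real (\<gamma> n) \<noteq> (0::complex)" using \<gamma>_pos[of n] by simp
  have x: "(a + 1 / a) * s (n + 1) a / of_real (\<gamma> n) = s n a + s (n + 2) a"
    "(w + 1 / w) * s (n + 1) w / of_real (\<gamma> n) = s n w + s (n + 2) w"
    unfolding s_recurrence[OF assms(1), symmetric] s_recurrence[OF assms(2), symmetric] using g by auto
  have "((a + 1 / a) - (w + 1 / w)) * (s (n + 1) a * s (n + 1) w / of_real (\<gamma> n))
    = ((a + 1 / a) * s (n + 1) a / of_real (\<gamma> n)) * s (n + 1) w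
      - s (n + 1) a * ((w + 1 / w) * s (n + 1) w / of_real (\<gamma> n))"
    by (simp only: left_diff_distrib diff_divide_distrib times_divide_eq_left times_divide_eq_right) (simp only: mult_ac diff_divide_distrib)
  also have "\<dots> = casoratian n a w - casoratian (Suc n) a w"
    unfolding x by (simp add: casoratian_def algebra_simps)
  finally show ?case using Suc by (simp add: distrib_left)
qed simp

text \<open>All decay comes from \<open>a\<close>, and the bound is uniform for \<open>w\<close> in
  the closed disc; this uniformity later permits Cauchy's inequality in \<open>w\<close>.\<close>

lemma casoratian_bound:
  obtains C where "C > 0" "\<And>n a w. norm a \<le> 1 \<Longrightarrow> norm w \<le> 1 \<Longrightarrow> norm (casoratian n a w) \<le> C * norm a ^ n"
proof -
  obtain C where C: "C > 0" "\<And>n z. norm z \<le> 1 \<Longrightarrow> norm (F n z) \<le> C"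
    using F_bounded[of 1] by blast
  have s: "norm (s n z) \<le> norm z ^ n * C" if "norm z \<le> 1" for n z
    unfolding s_def norm_mult norm_power using C(2)[OF that] by (intro mult_left_mono) auto
  have s1: "norm (s n z) \<le> C" if "norm z \<le> 1" for n z
  proof -
    have "norm z ^ n * C \<le> 1 * C" using that C by (intro mult_right_mono) (auto simp: power_le_one)
    then show ?thesis using s[OF that, of n] by simp
  qed
  have "norm (casoratian n a w) \<le> (2 * C\<^sup>2) * norm a ^ n" if "norm a \<le> 1" "norm w \<le> 1" for n a w
  proof -
    have "norm (s n a * s (n + 1) w) \<le> (norm a ^ n * C) * C"
      unfolding norm_mult using s s1 that C by (intro mult_mono) auto
    moreover have "norm (s (n + 1) a * s n w) \<le> (norm a ^ n * C) * C"
    proof -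
      have "norm a ^ (n + 1) * C \<le> norm a ^ n * C"
        using that C by (intro mult_right_mono power_decreasing) auto
      then have "norm (s (n + 1) a) \<le> norm a ^ n * C" using s[OF that(1), of "n + 1"] by linarith
      then show ?thesis unfolding norm_mult using s1 that C by (intro mult_mono) auto
    qed
    ultimately show ?thesis
      unfolding casoratian_def using norm_triangle_ineq4[of "s n a * s (n + 1) w" "s (n + 1) a * s n w"]
      by (simp add: power2_eq_square mult_ac)
  qed
  then show ?thesis using that[of "2 * C\<^sup>2"] C by simp
qed

lemma casoratian_tendsto_0:
  assumes "norm a < 1" "norm w \<le> 1"
  shows "(\<lambda>n. casoratian n a w) \<longlonglongrightarrow> 0"
proof -
  obtain C where C: "C > 0" "\<And>n a w. norm a \<le> 1 \<Longrightarrow> norm w \<le> 1 \<Longrightarrow> norm (casoratian n a w) \<le> C * norm a ^ n"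
    using casoratian_bound by blast
  have "(\<lambda>n. C * norm a ^ n) \<longlonglongrightarrow> C * 0"
    using assms by (intro tendsto_mult tendsto_const LIMSEQ_power_zero) auto
  then have "(\<lambda>n. C * norm a ^ n) \<longlonglongrightarrow> 0" by simp
  then show ?thesis
    by (rule Lim_null_comparison[rotated]) (intro always_eventually allI C(2), use assms in auto)
qed

text \<open>By Christoffel-Darboux the Casoratian at \<open>z\<close> and \<open>1 / z\<close> is
  independent of \<open>n\<close>. The powers of \<open>z\<close> cancel, so it equals the limit
  supplied by \<open>F_tendsto\<close>.\<close>

lemma Wronskian:
  assumes "z \<noteq> 0"
  shows "casoratian 0 z (1 / z) = Q (cq * z\<^sup>2) * Q (cq * (1 / z)\<^sup>2) * (1 / z - z)"
proof -
  have eq: "casoratian 0 z (1 / z) = F n z * F (Suc n) (1 / z) * (1 / z) - F (Suc n) z * F n (1 / z) * z" for n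
  proof -
    have "casoratian 0 z (1 / z) = casoratian n z (1 / z)"
      using Christoffel_Darboux[of z "1 / z" n] assms by simp
    moreover have "z ^ n * (1 / z) ^ n = 1" using assms by (simp add: power_divide)
    then have "z ^ n * F n z * ((1 / z) ^ (n + 1) * F (n + 1) (1 / z)) = F n z * F (Suc n) (1 / z) * (1 / z)"
      "z ^ (n + 1) * F (n + 1) z * ((1 / z) ^ n * F n (1 / z)) = F (Suc n) z * F n (1 / z) * z"
      by (simp_all add: mult_ac)
    ultimately show ?thesis by (simp only: casoratian_def s_def)
  qed
  have "(\<lambda>n. F n z * F (Suc n) (1 / z) * (1 / z) - F (Suc n) z * F n (1 / z) * z) \<longlonglongrightarrow>
      Q (cq * z\<^sup>2) * Q (cq * (1 / z)\<^sup>2) * (1 / z) - Q (cq * z\<^sup>2) * Q (cq * (1 / z)\<^sup>2) * z"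
    by (intro tendsto_diff tendsto_mult tendsto_const F_tendsto LIMSEQ_Suc[OF F_tendsto])
  then have "(\<lambda>n::nat. casoratian 0 z (1 / z)) \<longlonglongrightarrow>
      Q (cq * z\<^sup>2) * Q (cq * (1 / z)\<^sup>2) * (1 / z) - Q (cq * z\<^sup>2) * Q (cq * (1 / z)\<^sup>2) * z"
    by (simp only: eq[symmetric])
  then have "casoratian 0 z (1 / z) = Q (cq * z\<^sup>2) * Q (cq * (1 / z)\<^sup>2) * (1 / z) - Q (cq * z\<^sup>2) * Q (cq * (1 / z)\<^sup>2) * z"
    using LIMSEQ_unique tendsto_const by blast
  then show ?thesis by (simp only: right_diff_distrib)
qed

section \<open>Reality and simplicity of the zeros of \<open>F 0\<close>\<close>

lemma Q_square_nonzero: "norm z \<le> 1 \<Longrightarrow> Q (cq * z\<^sup>2) \<noteq> 0"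
proof (rule Q_nonzero)
  assume "norm z \<le> 1"
  then have "q * (norm z)\<^sup>2 \<le> q * 1" using q by (intro mult_left_mono) (auto simp: power_le_one)
  then have "q * (norm z)\<^sup>2 < 1" using q by linarith
  then show "norm (cq * z\<^sup>2) < 1" using q by (simp add: norm_mult norm_power)
qed

text \<open>The \<open>F n z\<close> have the nonzero limit \<open>Q (cq * z^2)\<close>. This
  supplies the strictly positive term in the arguments on zeros.\<close>

lemma s_not_all_zero:
  assumes "z \<noteq> 0" "norm z < 1"
  obtains n where "s (n + 1) z \<noteq> 0"
proof -
  have "\<exists>n. s (n + 1) z \<noteq> 0"
  proof (rule ccontr)
    assume "\<nexists>n. s (n + 1) z \<noteq> 0"
    then have "F (Suc n) z = 0" for n using assms by (simp add: s_def)
    then have "(\<lambda>n::nat. 0) \<longlonglongrightarrow> Q (cq * z\<^sup>2)" using LIMSEQ_Suc[OF F_tendsto[of z]] by (simp only:)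
    then have "Q (cq * z\<^sup>2) = 0" using LIMSEQ_unique tendsto_const by blast
    then show False using Q_square_nonzero assms by simp
  qed
  then show ?thesis using that by blast
qed

lemma F_zero_nonzero: "F 0 z = 0 \<Longrightarrow> z \<noteq> 0"
  using F_0_0_nonzero by auto

text \<open>Self-adjointness of the Jacobi operator: at a zero of \<open>F 0\<close> in the disc,
  the square-summable sequence \<open>s\<close> is an eigenvector with eigenvalue \<open>z + 1 / z\<close>.\<close>
lemma F_zero_real:
  assumes "F 0 z = 0" "norm z < 1"
  shows "Im z = 0"
proof -
  have z0: "z \<noteq> 0" using F_zero_nonzero assms by blast
  obtain k where k: "s (k + 1) z \<noteq> 0" using s_not_all_zero z0 assms by blast
  let ?t = "\<lambda>n. (norm (s (n + 1) z))\<^sup>2 / \<gamma> n"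
  \<comment> \<open>Christoffel-Darboux at \<open>z\<close> and \<open>cnj z\<close>: the summands
    are squared moduli over \<open>\<gamma> n\<close>, and the initial Casoratian vanishes because
    both points are zeros.\<close>
  have "(z + 1 / z) - (cnj z + 1 / cnj z) = 0"
  proof (rule zero_if_positive_sums_vanish[where t = ?t and k = k])
    fix N
    have "of_real (\<Sum>n<N. ?t n) = (\<Sum>n<N. s (n + 1) z * s (n + 1) (cnj z) / of_real (\<gamma> n))"
      by (simp add: cnj_s[symmetric] complex_norm_square del: of_real_power add: of_real_power[symmetric])
    moreover have "casoratian 0 z (cnj z) = 0"
      using assms cnj_F[of 0 z] by (simp add: casoratian_def s_def)
    ultimately show "((z + 1 / z) - (cnj z + 1 / cnj z)) * of_real (\<Sum>n<N. ?t n) = - casoratian N z (cnj z)"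
      using Christoffel_Darboux[of z "cnj z" N] z0 by simp
  next
    show "(\<lambda>N. - casoratian N z (cnj z)) \<longlonglongrightarrow> 0"
      using tendsto_minus[OF casoratian_tendsto_0[of z "cnj z"]] assms by simp
  qed (use k \<gamma>_pos in \<open>auto simp: less_imp_le\<close>)
  then have "z + 1 / z = cnj (z + 1 / z)" by simp
  then have "Im (z + 1 / z) = 0" by (metis Reals_cnj_iff complex_is_Real_iff)
  moreover have "Im (1 / z) = - Im z / (norm z)\<^sup>2"
    by (simp add: Im_divide cmod_power2)
  ultimately have "Im z - Im z / (norm z)\<^sup>2 = 0" by simp
  then have "Im z * ((norm z)\<^sup>2 - 1) = 0" using z0 by (simp add: field_simps)
  moreover have "(norm z)\<^sup>2 < 1" using assms by (simp add: power_less_one_iff)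
  ultimately show ?thesis by auto
qed

text \<open>Differentiate Christoffel-Darboux in \<open>w\<close> at \<open>w = a\<close>. At a
  double zero the initial Casoratian contributes nothing, so \<open>1 - 1 / a^2\<close> times a sum
  of squares tends to 0; this forces \<open>a^2 = 1\<close>, impossible inside the disc.\<close>

lemma F_zero_simple:
  assumes "F 0 a = 0" "norm a < 1"
  shows "deriv (F 0) a \<noteq> 0"
proof
  assume D: "deriv (F 0) a = 0"
  have a0: "a \<noteq> 0" using F_zero_nonzero assms by blast
  have "Im a = 0" using F_zero_real assms by blast
  then have cnj: "cnj a = a" by (simp add: complex_eq_iff)
  have real: "s n a = of_real (Re (s n a))" for n
    using cnj_s[of n a] cnj by (metis Reals_cnj_iff of_real_Re)
  obtain k where k: "s (k + 1) a \<noteq> 0" using s_not_all_zero a0 assms by blast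
  let ?t = "\<lambda>n. (Re (s (n + 1) a))\<^sup>2 / \<gamma> n"
  have casoratian_hol: "casoratian N a holomorphic_on S" for N S
    unfolding casoratian_def[abs_def] by (intro holomorphic_intros)
  have "1 - 1 / a\<^sup>2 = 0"
  proof (rule zero_if_positive_sums_vanish[where t = ?t and k = k])
    fix N
    let ?S = "\<lambda>w. \<Sum>n<N. s (n + 1) a * s (n + 1) w / of_real (\<gamma> n)"
    have S: "?S a = of_real (\<Sum>n<N. ?t n)"
      unfolding of_real_sum of_real_divide of_real_power
      by (intro sum.cong refl) (metis real power2_eq_square)
    have "?S holomorphic_on UNIV" using \<gamma>_pos by (intro holomorphic_intros) (simp add: less_imp_neq[THEN not_sym])
    then have "(?S has_field_derivative deriv ?S a) (at a)"
      by (rule holomorphic_derivI[OF _ open_UNIV]) auto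
    moreover have "((\<lambda>w. (a + 1 / a) - (w + 1 / w)) has_field_derivative - (1 - 1 / a\<^sup>2)) (at a)"
      using a0 by (auto intro!: derivative_eq_intros simp: power2_eq_square)
    ultimately have "((\<lambda>w. ((a + 1 / a) - (w + 1 / w)) * ?S w) has_field_derivative
        - (1 - 1 / a\<^sup>2) * ?S a + deriv ?S a * ((a + 1 / a) - (a + 1 / a))) (at a)"
      by (rule DERIV_mult[rotated])
    then have 1: "((\<lambda>w. ((a + 1 / a) - (w + 1 / w)) * ?S w) has_field_derivative - (1 - 1 / a\<^sup>2) * ?S a) (at a)"
      by (simp only: diff_self mult_zero_right add_0_right)
    have "((\<lambda>w. casoratian N a w) has_field_derivative deriv (casoratian N a) a) (at a)"
      by (rule holomorphic_derivI[OF casoratian_hol open_UNIV]) auto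
    moreover have "((\<lambda>w. casoratian 0 a w) has_field_derivative 0) (at a)"
    proof -
      have "(F 0 has_field_derivative 0) (at a)"
        using holomorphic_derivI[OF F_holomorphic open_UNIV, of a 0] D by simp
      then show ?thesis
        using assms by (auto simp: casoratian_def s_def intro!: derivative_eq_intros)
    qed
    ultimately have 2: "((\<lambda>w. casoratian 0 a w - casoratian N a w) has_field_derivative 0 - deriv (casoratian N a) a) (at a)"
      by (intro DERIV_diff)
    have "\<forall>\<^sub>F w in nhds a. w \<noteq> 0" using a0 by (intro t1_space_nhds)
    then have "\<forall>\<^sub>F w in nhds a. ((a + 1 / a) - (w + 1 / w)) * ?S w = casoratian 0 a w - casoratian N a w"
      by eventually_elim (rule Christoffel_Darboux[OF a0])
    then have "((\<lambda>w. casoratian 0 a w - casoratian N a w) has_field_derivative - (1 - 1 / a\<^sup>2) * ?S a) (at a)"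
      by (rule iffD1[OF DERIV_cong_ev[OF refl _ refl] 1])
    then have "- (1 - 1 / a\<^sup>2) * ?S a = 0 - deriv (casoratian N a) a" using 2 by (rule DERIV_unique)
    then show "(1 - 1 / a\<^sup>2) * of_real (\<Sum>n<N. ?t n) = deriv (casoratian N a) a"
      unfolding S by (simp only: mult_minus_left diff_0 neg_equal_iff_equal)
  next
    obtain C where C: "C > 0" "\<And>n a w. norm a \<le> 1 \<Longrightarrow> norm w \<le> 1 \<Longrightarrow> norm (casoratian n a w) \<le> C * norm a ^ n"
      using casoratian_bound by blast
    \<comment> \<open>With this radius the circle of Cauchy's inequality lies in the closed unit
      disc, where \<open>casoratian_bound\<close> is uniform.\<close>
    define \<rho> where "\<rho> = 1 - norm a"
    have \<rho>: "\<rho> > 0" using assms by (simp add: \<rho>_def)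
    have bound: "norm (deriv (casoratian N a) a) \<le> C / \<rho> * norm a ^ N" for N
    proof -
      have "norm ((deriv ^^ 1) (casoratian N a) a) \<le> fact 1 * (C * norm a ^ N) / \<rho> ^ 1"
      proof (rule Cauchy_inequality[OF casoratian_hol _ \<rho>])
        show "continuous_on (cball a \<rho>) (casoratian N a)" using casoratian_hol holomorphic_on_imp_continuous_on by blast
        fix x assume "norm (a - x) = \<rho>"
        then have "norm x \<le> 1" using norm_triangle_ineq4[of a "a - x"] by (simp add: \<rho>_def)
        then show "norm (casoratian N a x) \<le> C * norm a ^ N" using C assms by simp
      qed
      then show ?thesis by simp
    qed
    have "(\<lambda>N. C / \<rho> * norm a ^ N) \<longlonglongrightarrow> C / \<rho> * 0"
      using assms by (intro tendsto_mult tendsto_const LIMSEQ_power_zero) auto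
    then have "(\<lambda>N. C / \<rho> * norm a ^ N) \<longlonglongrightarrow> 0" by simp
    then show "(\<lambda>N. deriv (casoratian N a) a) \<longlonglongrightarrow> 0"
      by (rule Lim_null_comparison[rotated]) (intro always_eventually allI bound)
  next
    have "Re (s (k + 1) a) \<noteq> 0" using k real[of "k + 1"] by auto
    then show "?t k > 0" using \<gamma>_pos by simp
  qed (use \<gamma>_pos in \<open>auto simp: less_imp_le\<close>)
  then have "a\<^sup>2 = 1" using a0 by (simp add: field_simps)
  then have "norm a = 1" by (metis norm_one norm_power power_eq_1_iff zero_neq_numeral norm_ge_zero abs_norm_cancel)
  then show False using assms by simp
qed

text \<open>On the circle \<open>1 / z = cnj z\<close>, so a zero would annihilate the Casoratian at
  \<open>z\<close> and \<open>1 / z\<close>, whose value by \<open>Wronskian\<close> vanishes there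
  only if \<open>z^2 = 1\<close>.\<close>

lemma F_nonzero_on_circle:
  assumes "norm z = 1" "z\<^sup>2 \<noteq> 1"
  shows "F 0 z \<noteq> 0"
proof
  assume F: "F 0 z = 0"
  have z0: "z \<noteq> 0" using assms by auto
  have c: "1 / z = cnj z" using assms z0
    by (metis complex_norm_square nonzero_eq_divide_eq mult.commute of_real_1 power_one)
  have "F 0 (1 / z) = 0" using F cnj_F[of 0 z] c by simp
  then have "casoratian 0 z (1 / z) = 0" using F by (simp add: casoratian_def s_def)
  moreover have "Q (cq * z\<^sup>2) \<noteq> 0" "Q (cq * (1 / z)\<^sup>2) \<noteq> 0"
    using assms by (intro Q_square_nonzero; simp add: norm_divide)+
  ultimately have "1 / z - z = 0" using Wronskian[OF z0] by auto
  then show False using z0 assms by (simp add: field_simps power2_eq_square)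
qed

text \<open>Differentiate \<open>Wronskian\<close> at \<open>e\<close>. A double zero of
  \<open>F 0\<close> makes the derivative of the left side 0, whereas \<open>1 / w - w\<close> has a
  simple zero with derivative -2 and the \<open>Q\<close> factors do not vanish.\<close>

lemma F_zero_simple_at_edge:
  assumes e: "e\<^sup>2 = 1" and F: "F 0 e = 0"
  shows "deriv (F 0) e \<noteq> 0"
proof
  assume D: "deriv (F 0) e = 0"
  have e0: "e \<noteq> 0" using e by auto
  then have ee: "1 / e = e" using e by (simp add: divide_eq_eq power2_eq_square)
  have ne: "norm e = 1" using e by (metis norm_one norm_power power_eq_1_iff zero_neq_numeral norm_ge_zero abs_norm_cancel)
  let ?g = "\<lambda>w. Q (cq * w\<^sup>2) * Q (cq * (1 / w)\<^sup>2)"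
  have Qder: "(Q has_field_derivative deriv Q u) (at u)" for u
    by (rule holomorphic_derivI[OF Q_holomorphic open_UNIV]) auto
  have "\<exists>g'. (?g has_field_derivative g') (at e)"
    using e0 by (intro exI) (rule derivative_eq_intros DERIV_chain2[OF Qder] refl | simp)+
  then obtain g' where g': "(?g has_field_derivative g') (at e)" by blast
  have "((\<lambda>w. 1 / w - w) has_field_derivative - 2) (at e)"
    using e0 e by (auto intro!: derivative_eq_intros simp: power2_eq_square)
  from DERIV_mult[OF g' this] have 1: "((\<lambda>w. ?g w * (1 / w - w)) has_field_derivative - 2 * ?g e) (at e)"
    using ee by simp
  have F1: "(F 1 has_field_derivative deriv (F 1) u) (at u)" for u
    by (rule holomorphic_derivI[OF F_holomorphic open_UNIV]) auto
  have F0: "(F 0 has_field_derivative 0) (at e)"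
    using holomorphic_derivI[OF F_holomorphic open_UNIV, of e 0] D by simp
  have F0': "((\<lambda>w. F 0 (1 / w)) has_field_derivative 0) (at e)"
  proof -
    have "(F 0 has_field_derivative 0) (at (1 / e))" using F0 ee by simp
    moreover have "((\<lambda>w. 1 / w) has_field_derivative - 1) (at e)"
      using e0 e by (auto intro!: derivative_eq_intros simp: power2_eq_square)
    ultimately have "((\<lambda>w. F 0 (1 / w)) has_field_derivative 0 * (- 1)) (at e)"
      by (rule DERIV_chain2)
    then show ?thesis by simp
  qed
  have F1': "((\<lambda>w. F 1 (1 / w)) has_field_derivative deriv (F 1) (1 / e) * (- 1)) (at e)"
    using e0 e by (intro DERIV_chain2[OF F1]) (auto intro!: derivative_eq_intros simp: power2_eq_square)
  have Fe: "F 0 (1 / e) = 0" using F ee by simp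
  have 2: "((\<lambda>w. casoratian 0 w (1 / w)) has_field_derivative 0) (at e)"
  proof -
    have "\<exists>a'. ((\<lambda>w. 1 / w * F 1 (1 / w)) has_field_derivative a') (at e)"
      using e0 by (intro exI) (rule derivative_eq_intros F1' refl | simp)+
    then obtain a' where a: "((\<lambda>w. 1 / w * F 1 (1 / w)) has_field_derivative a') (at e)" by blast
    have "\<exists>b'. ((\<lambda>w. w * F 1 w) has_field_derivative b') (at e)"
      by (intro exI) (rule derivative_eq_intros F1 refl | simp)+
    then obtain b' where b: "((\<lambda>w. w * F 1 w) has_field_derivative b') (at e)" by blast
    have "((\<lambda>w. F 0 w * (1 / w * F 1 (1 / w)) - w * F 1 w * F 0 (1 / w)) has_field_derivative 0) (at e)"
      using DERIV_diff[OF DERIV_mult[OF F0 a] DERIV_mult[OF b F0']] F Fe by simp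
    then show ?thesis by (simp add: casoratian_def s_def)
  qed
  have "\<forall>\<^sub>F w in nhds e. w \<noteq> 0" using e0 by (intro t1_space_nhds)
  then have "\<forall>\<^sub>F w in nhds e. casoratian 0 w (1 / w) = ?g w * (1 / w - w)"
    by eventually_elim (rule Wronskian)
  then have "((\<lambda>w. ?g w * (1 / w - w)) has_field_derivative 0) (at e)"
    by (rule iffD1[OF DERIV_cong_ev[OF refl _ refl] 2])
  then have "- 2 * ?g e = 0" using 1 DERIV_unique by blast
  moreover have "Q (cq * e\<^sup>2) \<noteq> 0" using ne by (intro Q_square_nonzero) auto
  ultimately show False using ee by simp
qed

section \<open>The polynomials expressed by solutions of the recurrence\<close>

lemma P_mult_solution:
  assumes "\<And>n. of_real (\<gamma> n) * (t n + t (n + 2)) = of_real x * t (n + 1)" "t 0 = (0::complex)"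
  shows "of_real (P q \<alpha> \<beta> n x) * t 1 = of_real (G n) * t (n + 1)"
proof (induction n rule: induct_nat_012)
  case 0
  then show ?case by (simp add: G_0)
next
  case 1
  show ?case using assms(1)[of 0] assms(2) by (simp add: G_def)
next
  case (ge2 n)
  \<comment> \<open>\<open>G (Suc n) = G n * \<gamma> n\<close> makes the product of coefficients in
    the monic recurrence cancel the lower term of the recurrence for \<open>t\<close>.\<close>
  have "of_real (P q \<alpha> \<beta> (Suc (Suc n)) x) * t 1 = of_real x * (of_real (G (Suc n)) * t (n + 2))
      - of_real (\<gamma> n * \<gamma> (Suc n)) * (of_real (G n) * t (n + 1))"
    using ge2 by (simp add: algebra_simps)
  also have "\<dots> = of_real (G (Suc n)) * (of_real x * t (Suc n + 1)) - of_real (\<gamma> (Suc n)) * of_real (G (Suc n)) * t (n + 1)"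
    by (simp add: G_Suc algebra_simps)
  also have "\<dots> = of_real (G (Suc n)) * of_real (\<gamma> (Suc n)) * t (Suc (Suc n) + 1)"
    unfolding assms(1)[symmetric] by (simp add: algebra_simps)
  finally show ?case by (simp add: G_Suc mult_ac)
qed

text \<open>At a zero of \<open>F 0\<close> the Jost solution itself starts with 0, so it is
  proportional to the polynomials.\<close>

lemma P_at_zero:
  assumes "F 0 z = 0" "z + 1 / z = of_real x"
  shows "of_real (P q \<alpha> \<beta> n x) * F 1 z = of_real (G n) * z ^ n * F (n + 1) z"
proof -
  have z0: "z \<noteq> 0" using F_zero_nonzero assms by blast
  have "of_real (P q \<alpha> \<beta> n x) * s 1 z = of_real (G n) * s (n + 1) z"
    using assms s_recurrence[OF z0] by (intro P_mult_solution) (auto simp: s_def)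
  then show ?thesis using z0 by (simp add: s_def)
qed

text \<open>The combination \<open>t\<close> of the solutions for \<open>z\<close> and
  \<open>1 / z\<close> is chosen to vanish at index 0; its value at index 1 is minus their
  Casoratian.\<close>

lemma P_by_Jost:
  assumes "z \<noteq> 0" "z + 1 / z = of_real x"
  shows "of_real (P q \<alpha> \<beta> n x) * (Q (cq * z\<^sup>2) * Q (cq * (1 / z)\<^sup>2) * (z - 1 / z))
    = of_real (G n) * (F 0 (1 / z) * s (n + 1) z - F 0 z * s (n + 1) (1 / z))"
proof -
  define t where "t n = F 0 (1 / z) * s n z - F 0 z * s n (1 / z)" for n
  have "1 / z \<noteq> 0" using assms by simp
  note r = s_recurrence[OF assms(1)] s_recurrence[OF this]
  have "of_real (\<gamma> n) * (t n + t (n + 2)) = of_real x * t (n + 1)" for n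
  proof -
    have "of_real (\<gamma> n) * (t n + t (n + 2)) = F 0 (1 / z) * (of_real (\<gamma> n) * (s n z + s (n + 2) z))
       - F 0 z * (of_real (\<gamma> n) * (s n (1 / z) + s (n + 2) (1 / z)))"
      by (simp add: t_def algebra_simps)
    also have "\<dots> = of_real x * t (n + 1)"
      unfolding r using assms(2) by (simp add: t_def algebra_simps)
    finally show ?thesis .
  qed
  then have "of_real (P q \<alpha> \<beta> n x) * t 1 = of_real (G n) * t (n + 1)"
    by (intro P_mult_solution) (auto simp: t_def s_def)
  moreover have "t 1 = - casoratian 0 z (1 / z)" by (simp add: t_def casoratian_def s_def algebra_simps)
  then have "t 1 = Q (cq * z\<^sup>2) * Q (cq * (1 / z)\<^sup>2) * (z - 1 / z)"
    unfolding Wronskian[OF assms(1)] by (simp add: algebra_simps)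
  ultimately show ?thesis by (simp add: t_def)
qed

text \<open>The reversed form \<open>z ^ n * P n (z + 1 / z)\<close>, a polynomial in complex
  \<open>z\<close> that is regular at 0, whereas \<open>P\<close> takes real arguments only.\<close>

fun R :: "nat \<Rightarrow> complex \<Rightarrow> complex" where
  "R 0 z = 1"
| "R (Suc 0) z = 1 + z\<^sup>2"
| "R (Suc (Suc n)) z = (1 + z\<^sup>2) * R (Suc n) z - of_real (\<gamma> n * \<gamma> (Suc n)) * z\<^sup>2 * R n z"

lemma R_holomorphic [holomorphic_intros]: "R n holomorphic_on S"
  by (induction n rule: induct_nat_012) (auto intro!: holomorphic_intros)

lemma R_at_0: "R n 0 = 1"
  by (induction n rule: induct_nat_012) auto

lemma R_eq_P:
  assumes "z \<noteq> 0" "z + 1 / z = of_real x"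
  shows "R n z = z ^ n * of_real (P q \<alpha> \<beta> n x)"
proof (induction n rule: induct_nat_012)
  case 1
  then show ?case using assms by (simp flip: assms(2) add: field_simps power2_eq_square)
next
  case (ge2 n)
  have "1 + z\<^sup>2 = z * of_real x" using assms by (simp flip: assms(2) add: field_simps power2_eq_square)
  then show ?case using ge2 by (simp add: algebra_simps power2_eq_square)
qed simp

end

section \<open>The contour integral\<close>

lemma holomorphic_zero_factor:
  fixes f :: "complex \<Rightarrow> complex"
  assumes "f holomorphic_on UNIV" "f e = 0"
  obtains h where "h holomorphic_on UNIV" "\<And>z. f z = (z - e) * h z" "h e = deriv f e"
proof -
  let ?h = "\<lambda>z. if z = e then deriv f e else (f z - f e) / (z - e)"
  have "?h holomorphic_on UNIV" using assms by (intro pole_lemma) auto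
  then show ?thesis using that[of ?h] assms(2) by auto
qed

text \<open>Symmetry is asked only in the open interval: the identities for the integrand are
  available only away from \<open>z = 1\<close> and \<open>z = -1\<close>, and endpoints are
  negligible.\<close>

lemma integral_symmetric_2pi:
  fixes k :: "real \<Rightarrow> real"
  assumes k: "(k has_integral I) {0..2 * pi}" and sym: "\<And>t. 0 < t \<Longrightarrow> t < pi \<Longrightarrow> k (2 * pi - t) = k t"
  shows "integral {0..pi} k = I / 2"
proof -
  have int: "k integrable_on {0..2 * pi}" using k by blast
  then have 1: "k integrable_on {0..pi}" and 2: "k integrable_on {pi..2 * pi}"
    by (auto intro: integrable_on_subinterval)
  have I: "I = integral {0..pi} k + integral {pi..2 * pi} k"
    using Henstock_Kurzweil_Integration.integral_combine[OF _ _ int, of pi] integral_unique[OF k] by simp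
  have "((\<lambda>t. k (2 * pi - t)) has_integral integral {pi..2 * pi} k) {0..pi}"
  proof -
    have "(k has_integral integral {pi..2 * pi} k) (cbox pi (2 * pi))"
      using 2 by (simp add: integrable_integral)
    from has_integral_affinity[OF this, of "-1" "2 * pi"]
    have "((\<lambda>t. k (2 * pi - t)) has_integral integral {pi..2 * pi} k) ((\<lambda>x. - x + 2 * pi) ` {pi..2 * pi})"
      by simp
    moreover have "(\<lambda>x. - x + 2 * pi) ` {pi..2 * pi} = {0..pi}"
    proof safe
      fix x assume "x \<in> {0..pi}"
      then show "x \<in> (\<lambda>x. - x + 2 * pi) ` {pi..2 * pi}"
        by (intro image_eqI[where x = "2 * pi - x"]) auto
    qed auto
    ultimately show ?thesis by simp
  qed
  then have "integral {pi..2 * pi} k = integral {0..pi} (\<lambda>t. k (2 * pi - t))" by (simp add: integral_unique)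
  also have "\<dots> = integral {0..pi} k"
    by (rule integral_spike[where S = "{0, pi}"]) (use sym in auto)
  finally show ?thesis using I by simp
qed

context parameters
begin

text \<open>Radius 2 leaves an open neighbourhood of the unit circle. Zeros at 1 and -1 are left out
  because \<open>z^2 - 1\<close> cancels them.\<close>

definition Z :: "complex set" where "Z = {z \<in> ball 0 2. F 0 z = 0 \<and> z\<^sup>2 \<noteq> 1}"

lemma finite_F_zeros: "finite {z \<in> cball 0 2. F 0 z = 0}"
proof (cases "F 0 constant_on UNIV")
  case True
  then have "F 0 z \<noteq> 0" for z using F_0_0_nonzero unfolding constant_on_def by auto
  then show ?thesis by simp
next
  case False
  then show ?thesis
    by (intro holomorphic_compact_finite_zeros[where S = UNIV] F_holomorphic) auto
qed

lemma finite_Z: "finite Z"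
  by (rule finite_subset[OF _ finite_F_zeros]) (auto simp: Z_def)

text \<open>A zero of \<open>F 0\<close> at \<open>\<plusminus>1\<close> is simple, so the factor \<open>z\<^sup>2 - 1\<close> cancels it.\<close>
lemma quotient_extension:
  obtains E where "E holomorphic_on ball 0 2 - Z" "\<And>z. z\<^sup>2 \<noteq> 1 \<Longrightarrow> E z = (z\<^sup>2 - 1) / F 0 z"
proof (cases "F 0 1 = 0")
  case False
  have "F 0 z \<noteq> 0" if "z \<in> ball 0 2 - Z" for z
    using that False F_even[of 0 1] by (auto simp: Z_def power2_eq_1_iff)
  then have "(\<lambda>z. (z\<^sup>2 - 1) / F 0 z) holomorphic_on ball 0 2 - Z" by (intro holomorphic_intros)
  then show ?thesis using that by blast
next
  case True
  obtain g where g: "g holomorphic_on UNIV" "\<And>z. F 0 z = (z - 1) * g z" "g 1 = deriv (F 0) 1"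
    using holomorphic_zero_factor[of "F 0" 1] F_holomorphic True by blast
  \<comment> \<open>\<open>F 0\<close> is even, so 1 and -1 are zeros together and the whole factor
    \<open>z^2 - 1\<close> splits off.\<close>
  have Fm: "F 0 (-1) = 0" using F_even[of 0 1] True by simp
  then have "g (-1) = 0" using g(2)[of "-1"] by simp
  then obtain h where h: "h holomorphic_on UNIV" "\<And>z. g z = (z - (-1)) * h z" "h (-1) = deriv g (-1)"
    using holomorphic_zero_factor[OF g(1)] by blast
  have eq: "F 0 z = (z\<^sup>2 - 1) * h z" for z
    unfolding g(2) h(2) by (simp add: power2_eq_square algebra_simps)
  have "h z \<noteq> 0" if "z \<in> ball 0 2 - Z" for z
  proof (cases "z\<^sup>2 = 1")
    case False
    then show ?thesis using that by (auto simp: Z_def eq)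
  next
    case True
    then have "F 0 z = 0" by (simp add: eq)
    then have "deriv (F 0) z \<noteq> 0" using F_zero_simple_at_edge True by blast
    moreover have "deriv (F 0) z = 2 * z * h z"
    proof -
      have "(h has_field_derivative deriv h z) (at z)"
        by (rule holomorphic_derivI[OF h(1) open_UNIV]) auto
      then have "((\<lambda>z. (z\<^sup>2 - 1) * h z) has_field_derivative 2 * z * h z) (at z)"
        using True by (auto intro!: derivative_eq_intros)
      then have "(F 0 has_field_derivative 2 * z * h z) (at z)" by (simp only: eq[symmetric])
      then show ?thesis by (rule DERIV_imp_deriv)
    qed
    ultimately show ?thesis by auto
  qed
  then have "(\<lambda>z. 1 / h z) holomorphic_on ball 0 2 - Z"
    using h(1) by (intro holomorphic_intros) (auto intro: holomorphic_on_subset)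
  then show ?thesis using that[of "\<lambda>z. 1 / h z"] by (simp add: eq)
qed

text \<open>The residue of the contour integrand at a simple zero \<open>p\<close> of
  \<open>F 0\<close>: \<open>1 / F 0\<close> is replaced by
  \<open>1 / deriv (F 0) p\<close>.\<close>

definition res :: "nat \<Rightarrow> nat \<Rightarrow> complex \<Rightarrow> complex" where
  "res m n p = R m p * F (n + 1) p * ((p\<^sup>2 - 1) / deriv (F 0) p) * p ^ (n - m) / p"

text \<open>Inside the circle the only possible poles are 0 and the points of \<open>Z\<close>.
  \<open>E\<close> is used for the quotient so that \<open>K\<close> is holomorphic across 1 and -1
  as well.\<close>

lemma contour_integral_residues:
  assumes E: "E holomorphic_on ball 0 2 - Z" "\<And>z. z\<^sup>2 \<noteq> 1 \<Longrightarrow> E z = (z\<^sup>2 - 1) / F 0 z"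
    and mn: "m \<le> n"
  defines "K \<equiv> \<lambda>z. R m z * F (n + 1) z * E z * z ^ (n - m) / z"
  shows "(K has_contour_integral 2 * pi * \<i> * ((if m = n then - of_real (G (n + 1)) else 0)
      + (\<Sum>p\<in>Z \<inter> ball 0 1. res m n p))) (circlepath 0 1)"
proof -
  let ?S = "ball 0 2 - Z :: complex set"
  have openS: "open ?S" using finite_Z by (intro open_Diff finite_imp_closed) auto
  have Z0: "0 \<notin> Z" using F_0_0_nonzero by (simp add: Z_def)
  have hol0: "(\<lambda>z. R m z * F (n + 1) z * E z * z ^ (n - m)) holomorphic_on ?S"
    by (intro holomorphic_intros E)
  then have hol: "K holomorphic_on ball 0 2 - insert 0 Z"
    unfolding K_def by (intro holomorphic_on_divide holomorphic_on_ident) (auto intro: holomorphic_on_subset)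
  have Zcirc: "norm z \<noteq> 1" if "z \<in> Z" for z
    using that F_nonzero_on_circle by (auto simp: Z_def)
  have path: "path_image (circlepath 0 1) \<subseteq> ball 0 2 - insert 0 Z"
    using Zcirc by auto
  have int: "K contour_integrable_on circlepath 0 1"
    using finite_Z by (intro contour_integrable_holomorphic_simple[OF hol _ _ path] open_Diff finite_imp_closed) auto
  have wn_out: "winding_number (circlepath 0 1) z = 0" if "norm z > 1" for z
    by (rule winding_number_zero_outside[where s = "cball 0 1"]) (use that in auto)
  have wn_in: "winding_number (circlepath 0 1) z = 1" if "norm z < 1" for z
    using that by (intro winding_number_circlepath) auto
  \<comment> \<open>For \<open>m < n\<close> the power \<open>z ^ (n - m)\<close> removes the pole.
    For \<open>m = n\<close> the value is \<open>F (n + 1) 0 * (- 1 / F 0 0)\<close>, which is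
    \<open>- G (n + 1)\<close> by \<open>F_at_0\<close>.\<close>
  have res0: "residue K 0 = (if m = n then - of_real (G (n + 1)) else 0)"
  proof -
    have "residue K 0 = R m 0 * F (n + 1) 0 * E 0 * 0 ^ (n - m)"
      unfolding K_def using residue_simple[OF openS _ hol0, of 0] Z0 by simp
    also have "\<dots> = (if m = n then - of_real (G (n + 1)) else 0)"
      using mn F_0_0_nonzero F_at_0[of "n + 1"] by (simp add: R_at_0 E(2) power_0_left)
    finally show ?thesis .
  qed
  have resp: "residue K p = res m n p" if p: "p \<in> Z" "norm p < 1" for p
  proof (rule residue_simple')
    let ?s = "ball 0 2 - insert 0 (Z - {p}) :: complex set"
    have p0: "p \<noteq> 0" using Z0 p by auto
    show "open ?s" using finite_Z by (intro open_Diff finite_imp_closed) auto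
    show "p \<in> ?s" using p p0 by (auto simp: Z_def)
    show "K holomorphic_on ?s - {p}" by (rule holomorphic_on_subset[OF hol]) auto
    have Fp: "F 0 p = 0" and p1: "p\<^sup>2 \<noteq> 1" using p by (auto simp: Z_def)
    have D: "deriv (F 0) p \<noteq> 0" using F_zero_simple Fp p by blast
    have "(F 0 has_field_derivative deriv (F 0) p) (at p)"
      by (rule holomorphic_derivI[OF F_holomorphic open_UNIV]) auto
    then have q': "((\<lambda>w. F 0 w / (w - p)) \<longlongrightarrow> deriv (F 0) p) (at p)"
      using Fp by (simp add: has_field_derivative_iff)
    have cont: "(f \<longlongrightarrow> f p) (at p)" if "f holomorphic_on UNIV" for f :: "complex \<Rightarrow> complex"
      using holomorphic_on_imp_continuous_on[OF that] by (simp add: continuous_on_def)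
    have lim: "((\<lambda>w. R m w * F (n + 1) w * ((w\<^sup>2 - 1) / (F 0 w / (w - p))) * w ^ (n - m) / w) \<longlongrightarrow> res m n p) (at p)"
      unfolding res_def using D p0
      by (intro tendsto_mult tendsto_divide tendsto_diff tendsto_power tendsto_ident_at tendsto_const
          q' cont[OF R_holomorphic] cont[OF F_holomorphic])
    have "\<forall>\<^sub>F w in at p. w \<in> {w. w\<^sup>2 \<noteq> 1}"
    proof (rule eventually_at_in_open')
      have "open (- {1, - 1 :: complex})" by (intro open_Compl finite_imp_closed) auto
      moreover have "- {1, - 1} = {w :: complex. w\<^sup>2 \<noteq> 1}" by (auto simp: power2_eq_1_iff)
      ultimately show "open {w :: complex. w\<^sup>2 \<noteq> 1}" by simp
    qed (use p1 in auto)
    then have "\<forall>\<^sub>F w in at p. R m w * F (n + 1) w * ((w\<^sup>2 - 1) / (F 0 w / (w - p))) * w ^ (n - m) / w = K w * (w - p)"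
      by eventually_elim (simp add: K_def E(2))
    then show "((\<lambda>w. K w * (w - p)) \<longlongrightarrow> res m n p) (at p)"
      using lim by (rule Lim_transform_eventually[rotated])
  qed
  have "contour_integral (circlepath 0 1) K =
      2 * pi * \<i> * (\<Sum>p\<in>insert 0 Z. winding_number (circlepath 0 1) p * residue K p)"
    by (rule Residue_theorem[OF _ _ _ hol _ _ path]) (auto simp: finite_Z intro!: wn_out)
  also have "(\<Sum>p\<in>insert 0 Z. winding_number (circlepath 0 1) p * residue K p)
      = residue K 0 + (\<Sum>p\<in>Z. winding_number (circlepath 0 1) p * residue K p)"
    using finite_Z Z0 wn_in[of 0] by simp
  \<comment> \<open>Points of \<open>Z\<close> outside the circle have winding number 0, and none
    lies on it.\<close>
  also have "(\<Sum>p\<in>Z. winding_number (circlepath 0 1) p * residue K p)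
      = (\<Sum>p\<in>Z \<inter> ball 0 1. winding_number (circlepath 0 1) p * residue K p)"
  proof (rule sum.mono_neutral_right)
    show "\<forall>p\<in>Z - Z \<inter> ball 0 1. winding_number (circlepath 0 1) p * residue K p = 0"
      using Zcirc wn_out by (auto simp: not_less order.order_iff_strict)
  qed (auto simp: finite_Z)
  also have "\<dots> = (\<Sum>p\<in>Z \<inter> ball 0 1. res m n p)"
    using wn_in resp by (intro sum.cong) auto
  finally show ?thesis
    using has_contour_integral_integral[OF int] res0 by simp
qed

section \<open>From the weight on the interval to the contour integral\<close>

lemma phi21_eq: "phi21 q \<alpha> \<beta> t = F 0 (cis t) / Q (cq * (cis t)\<^sup>2)"
proof -
  let ?z = "cis t"
  have nz: "Q (cq * ?z\<^sup>2) \<noteq> 0" by (intro Q_square_nonzero) auto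
  have "cc q \<alpha> \<beta> k ?z / (qpoch (cq * ?z\<^sup>2) cq k * qpoch cq cq k) = A k ?z / Q (cq * ?z\<^sup>2)" for k
  proof -
    have Q: "Q (cq * ?z\<^sup>2) = qpoch (cq * ?z\<^sup>2) cq k * Q (cq ^ (k + 1) * ?z\<^sup>2)"
      by (subst Q_split[of _ k]) (simp add: mult_ac)
    then have "Q (cq ^ (k + 1) * ?z\<^sup>2) \<noteq> 0" using nz by auto
    then show ?thesis unfolding A_def Q by simp
  qed
  then have "phi21 q \<alpha> \<beta> t = (\<Sum>k. A k ?z / Q (cq * ?z\<^sup>2))" unfolding phi21_def by (simp only:)
  also have "\<dots> = (\<Sum>k. A k ?z) / Q (cq * ?z\<^sup>2)"
    using summable_F[of ?z 0] by (intro suminf_divide) simp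
  finally show ?thesis by (simp add: F_def)
qed

lemma cnj_R: "cnj (R n z) = R n (cnj z)"
  by (induction n rule: induct_nat_012) auto

text \<open>Only \<open>P n\<close> is rewritten by \<open>P_by_Jost\<close>; with
  \<open>1 / z = cnj z\<close> its right side becomes an imaginary part, and the weight leaves
  \<open>Im (s (n + 1) z / F 0 z)\<close>. \<open>P m\<close> stays a polynomial, so the result is
  the real part of an analytic integrand. The last factor \<open>z\<close> comes from
  \<open>dz = i z dt\<close>.\<close>

lemma weight_identity:
  fixes t :: real
  defines "z \<equiv> cis t"
  assumes t: "(cis t)\<^sup>2 \<noteq> 1" and mn: "m \<le> n"
  shows "P q \<alpha> \<beta> m (2 * cos t) * P q \<alpha> \<beta> n (2 * cos t) * (sin t)\<^sup>2 / (cmod (phi21 q \<alpha> \<beta> t))\<^sup>2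
    = - (G n / 2) * Re (R m z * F (n + 1) z * ((z\<^sup>2 - 1) / F 0 z) * z ^ (n - m) / z * z)"
proof -
  have z0: "z \<noteq> 0" and nz: "norm z = 1" by (auto simp: z_def)
  have inv: "1 / z = cnj z" by (simp add: z_def cis_cnj divide_inverse)
  have x: "z + 1 / z = of_real (2 * cos t)" unfolding inv by (simp add: z_def complex_eq_iff)
  have y: "z - cnj z = 2 * \<i> * of_real (sin t)" by (simp add: z_def complex_eq_iff)
  let ?Pm = "P q \<alpha> \<beta> m (2 * cos t)" and ?Pn = "P q \<alpha> \<beta> n (2 * cos t)"
  let ?f = "F 0 z" and ?S = "s (n + 1) z" and ?Q = "Q (cq * z\<^sup>2)"
  have f0: "?f \<noteq> 0" using F_nonzero_on_circle[OF nz] t by (simp add: z_def)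
  have Qc: "Q (cq * (cnj z)\<^sup>2) = cnj ?Q" by (simp add: cnj_Q)
  have "of_real ?Pn * (?Q * cnj ?Q * (2 * \<i> * of_real (sin t)))
      = of_real (G n) * (cnj ?f * ?S - ?f * cnj ?S)"
    using P_by_Jost[OF z0 x, of n] unfolding inv Qc y by (simp only: cnj_F cnj_s)
  moreover have "?Q * cnj ?Q = of_real ((cmod ?Q)\<^sup>2)" by (rule complex_norm_square[symmetric])
  moreover have "cnj ?f * ?S - ?f * cnj ?S = 2 * \<i> * of_real (Im (?S * cnj ?f))"
    by (simp add: complex_eq_iff)
  ultimately have "of_real (?Pn * ((cmod ?Q)\<^sup>2 * sin t)) = (of_real (G n * Im (?S * cnj ?f)) :: complex)"
    by simp
  then have Pn: "?Pn * ((cmod ?Q)\<^sup>2 * sin t) = G n * Im (?S * cnj ?f)" by (simp only: of_real_eq_iff)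
  have Im: "Im (?S * cnj ?f) = Im (?S / ?f) * (cmod ?f)\<^sup>2"
  proof -
    have "?S * cnj ?f = ?S / ?f * of_real ((cmod ?f)\<^sup>2)"
      using f0 unfolding complex_norm_square by simp
    then show ?thesis by (simp only: times_complex.sel Re_complex_of_real Im_complex_of_real)
  qed
  have "?Pm * ?Pn * (sin t)\<^sup>2 / (cmod (phi21 q \<alpha> \<beta> t))\<^sup>2
     = ?Pm * sin t * (?Pn * ((cmod ?Q)\<^sup>2 * sin t)) / (cmod ?f)\<^sup>2"
    unfolding phi21_eq z_def[symmetric] norm_divide power_divide by (simp add: power2_eq_square mult_ac)
  also have "\<dots> = ?Pm * sin t * G n * Im (?S / ?f)"
    unfolding Pn Im using f0 by simp
  finally have L: "?Pm * ?Pn * (sin t)\<^sup>2 / (cmod (phi21 q \<alpha> \<beta> t))\<^sup>2 = ?Pm * sin t * G n * Im (?S / ?f)" .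
  have "R m z * F (n + 1) z * ((z\<^sup>2 - 1) / ?f) * z ^ (n - m) / z * z
     = of_real ?Pm * (z ^ m * z ^ (n - m) * F (n + 1) z) * (z\<^sup>2 - 1) / ?f"
    unfolding R_eq_P[OF z0 x] using z0 by simp
  also have "\<dots> = of_real (2 * ?Pm * sin t) * (\<i> * (?S / ?f))"
  proof -
    have "z ^ m * z ^ (n - m) = z ^ n" using mn by (simp flip: power_add)
    moreover have "z\<^sup>2 - 1 = z * (2 * \<i> * of_real (sin t))"
      unfolding y[symmetric] inv[symmetric] using z0 by (simp add: power2_eq_square algebra_simps)
    ultimately show ?thesis by (simp add: s_def mult_ac)
  qed
  finally have eq: "R m z * F (n + 1) z * ((z\<^sup>2 - 1) / ?f) * z ^ (n - m) / z * z
     = of_real (2 * ?Pm * sin t) * (\<i> * (?S / ?f))" .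
  have "Re (R m z * F (n + 1) z * ((z\<^sup>2 - 1) / ?f) * z ^ (n - m) / z * z) = - (2 * ?Pm * sin t) * Im (?S / ?f)"
    unfolding eq by (simp only: times_complex.sel Re_complex_of_real Im_complex_of_real) simp
  then show ?thesis unfolding L by simp
qed

lemma weighted_integral:
  assumes mn: "m \<le> n"
  shows "(2 / pi) * integral {0..pi} (\<lambda>t. P q \<alpha> \<beta> m (2 * cos t) * P q \<alpha> \<beta> n (2 * cos t)
      * (sin t)\<^sup>2 / (cmod (phi21 q \<alpha> \<beta> t))\<^sup>2)
    = (if m = n then G n * G (n + 1) else 0) - G n * Re (\<Sum>p\<in>Z \<inter> ball 0 1. res m n p)"
proof -
  obtain E where E: "E holomorphic_on ball 0 2 - Z" "\<And>z. z\<^sup>2 \<noteq> 1 \<Longrightarrow> E z = (z\<^sup>2 - 1) / F 0 z"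
    using quotient_extension by blast
  define K where "K z = R m z * F (n + 1) z * E z * z ^ (n - m) / z" for z
  define W where "W = (if m = n then - of_real (G (n + 1)) else 0) + (\<Sum>p\<in>Z \<inter> ball 0 1. res m n p)"
  have "(K has_contour_integral 2 * pi * \<i> * W) (part_circlepath 0 1 0 (2 * pi))"
    using contour_integral_residues[OF E mn] unfolding K_def W_def circlepath_def .
  then have "((\<lambda>t. K (cis t) * \<i> * cis t) has_integral 2 * pi * \<i> * W) {0..2 * pi}"
    by (simp add: has_contour_integral_part_circlepath_iff)
  \<comment> \<open>Multiplication by \<open>- \<i>\<close> removes the imaginary unit of
    \<open>dz = i z dt\<close>.\<close>
  from has_integral_mult_right[OF this, of "- \<i>"]
  have "((\<lambda>t. K (cis t) * cis t) has_integral 2 * pi * W) {0..2 * pi}" by (simp add: mult_ac)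
  from has_integral_Re[OF this]
  have int: "((\<lambda>t. Re (K (cis t) * cis t)) has_integral 2 * pi * Re W) {0..2 * pi}" by simp
  have edge: "(cis t)\<^sup>2 \<noteq> 1" if "0 < t" "t < pi" for t
  proof
    assume "(cis t)\<^sup>2 = 1"
    then have "cis t = 1 \<or> cis t = - 1" by (simp only: power2_eq_1_iff)
    then have "Im (cis t) = 0" by (elim disjE) (simp_all only: uminus_complex.sel one_complex.sel minus_zero)
    then show False using sin_gt_zero[OF that] by simp
  qed
  have "integral {0..pi} (\<lambda>t. Re (K (cis t) * cis t)) = 2 * pi * Re W / 2"
  proof (rule integral_symmetric_2pi[OF int])
    fix t :: real assume t: "0 < t" "t < pi"
    \<comment> \<open>Reflection in \<open>pi\<close> is complex conjugation on the circle, and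
      \<open>K (z) * z\<close> commutes with it there.\<close>
    have c: "cis (2 * pi - t) = cnj (cis t)" by (simp add: complex_eq_iff cos_diff sin_diff)
    have e: "(cnj (cis t))\<^sup>2 \<noteq> 1" using edge[OF t] by (metis complex_cnj_power complex_cnj_one_iff)
    have "K (cnj (cis t)) * cnj (cis t) = cnj (K (cis t) * cis t)"
      unfolding K_def E(2)[OF edge[OF t]] E(2)[OF e] by (simp add: cnj_R cnj_F)
    then show "Re (K (cis (2 * pi - t)) * cis (2 * pi - t)) = Re (K (cis t) * cis t)"
      unfolding c by simp
  qed
  moreover have "integral {0..pi} (\<lambda>t. P q \<alpha> \<beta> m (2 * cos t) * P q \<alpha> \<beta> n (2 * cos t)
      * (sin t)\<^sup>2 / (cmod (phi21 q \<alpha> \<beta> t))\<^sup>2) = integral {0..pi} (\<lambda>t. - (G n / 2) * Re (K (cis t) * cis t))"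
  \<comment> \<open>At the endpoints \<open>phi21\<close> may vanish, where division gives 0; two
    points do not affect the integral.\<close>
  proof (rule integral_spike[where S = "{0, pi}"])
    fix t assume "t \<in> {0..pi} - {0, pi}"
    then have t: "0 < t" "t < pi" by auto
    show "- (G n / 2) * Re (K (cis t) * cis t) = P q \<alpha> \<beta> m (2 * cos t) * P q \<alpha> \<beta> n (2 * cos t)
      * (sin t)\<^sup>2 / (cmod (phi21 q \<alpha> \<beta> t))\<^sup>2"
      unfolding weight_identity[OF edge[OF t] mn] K_def E(2)[OF edge[OF t]] ..
  qed auto
  moreover have "Re W = (if m = n then - G (n + 1) else 0) + Re (\<Sum>p\<in>Z \<inter> ball 0 1. res m n p)"
    by (simp add: W_def)
  ultimately have "(2 / pi) * integral {0..pi} (\<lambda>t. P q \<alpha> \<beta> m (2 * cos t) * P q \<alpha> \<beta> n (2 * cos t)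
      * (sin t)\<^sup>2 / (cmod (phi21 q \<alpha> \<beta> t))\<^sup>2)
    = (2 / pi) * (- (G n / 2) * (2 * pi * ((if m = n then - G (n + 1) else 0) + Re (\<Sum>p\<in>Z \<inter> ball 0 1. res m n p)) / 2))"
    by (simp only: integral_mult_right)
  also have "(2 / pi) * (- (g / 2) * (2 * pi * w / 2)) = - g * w" for g w by simp
  finally show ?thesis by (simp add: algebra_simps)
qed

section \<open>Return to the real functions \<open>psi\<close>\<close>

lemma of_real_series_eq_F:
  assumes "\<And>k. of_real (a k) = A k z * cq ^ (n * k)"
  shows "of_real (\<Sum>k. a k) = F n z"
proof -
  have "(\<lambda>k. of_real (a k)) sums F n z"
    unfolding assms F_def by (intro summable_sums summable_F)
  then have "a sums Re (F n z)" "(\<lambda>k. 0) sums Im (F n z)"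
    by (simp_all add: sums_complex_iff)
  then have "suminf a = Re (F n z)" "Im (F n z) = 0"
    using sums_unique2[OF sums_zero] by (auto simp: sums_iff)
  then show ?thesis by (simp add: complex_eq_iff)
qed

lemma of_real_A:
  "of_real (qpoch_inf (q ^ (k + 1) * z\<^sup>2) q / qpoch q q k * cc q \<alpha> \<beta> k z) = A k (of_real z)"
  by (simp add: A_def of_real_qpoch_inf of_real_qpoch cc_def)

lemma psi_minus_1: "of_real (psi q \<alpha> \<beta> (-1) z) = F 0 (of_real z) / of_real z"
proof -
  have "of_real (\<Sum>k. qpoch_inf (q ^ (k + 1) * z\<^sup>2) q / qpoch q q k * cc q \<alpha> \<beta> k z * q powi ((-1 + 1) * int k)) = F 0 (of_real z)"
    by (rule of_real_series_eq_F) (simp flip: of_real_A)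
  then show ?thesis unfolding psi_def of_real_mult by (simp add: field_simps)
qed

lemma psi_0: "of_real (psi q \<alpha> \<beta> 0 z) = F 1 (of_real z)"
proof -
  have "of_real (\<Sum>k. qpoch_inf (q ^ (k + 1) * z\<^sup>2) q / qpoch q q k * cc q \<alpha> \<beta> k z * q powi ((0 + 1) * int k)) = F 1 (of_real z)"
    by (rule of_real_series_eq_F) (simp flip: of_real_A)
  then show ?thesis unfolding psi_def of_real_mult by simp
qed

text \<open>The quotient rule for \<open>F 0\<close> divided by the variable, whose second term
  vanishes at a zero. Since \<open>F 0\<close> is real on the real line, its derivative there is
  real too.\<close>

lemma deriv_psi_at_zero:
  assumes "F 0 (of_real z) = 0"
  shows "of_real (deriv (psi q \<alpha> \<beta> (-1)) z) = deriv (F 0) (of_real z) / of_real z"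
proof -
  have z0: "z \<noteq> 0" using F_zero_nonzero assms by force
  let ?D = "deriv (F 0) (of_real z)"
  have "(F 0 has_field_derivative ?D) (at (of_real z))"
    by (rule holomorphic_derivI[OF F_holomorphic open_UNIV]) auto
  then have v: "((\<lambda>x. F 0 (of_real x)) has_vector_derivative ?D) (at z)"
    by (rule has_vector_derivative_real_field)
  have "Im (F 0 (of_real x)) = 0" for x
    using cnj_F[of 0 "of_real x"] by (simp add: complex_eq_iff)
  then have "((\<lambda>x. 0) has_real_derivative Im ?D) (at z)"
    using has_field_derivative_Im[OF v] by simp
  then have D: "?D = of_real (Re ?D)"
    using DERIV_unique[OF DERIV_const] by (metis complex_eq_iff Re_complex_of_real Im_complex_of_real)
  have "((\<lambda>x. Re (F 0 (of_real x)) / x) has_real_derivative (Re ?D * z - Re (F 0 (of_real z)) * 1) / (z * z)) (at z)"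
    by (rule DERIV_divide[OF has_field_derivative_Re[OF v] DERIV_ident z0])
  then have "((\<lambda>x. Re (F 0 (of_real x)) / x) has_real_derivative Re ?D / z) (at z)"
    using assms z0 by simp
  moreover have "psi q \<alpha> \<beta> (-1) = (\<lambda>x. Re (F 0 (of_real x)) / x)"
  proof
    fix x show "psi q \<alpha> \<beta> (-1) x = Re (F 0 (of_real x)) / x"
      using arg_cong[OF psi_minus_1[of x], of Re] by (simp add: Re_divide_of_real)
  qed
  ultimately have "deriv (psi q \<alpha> \<beta> (-1)) z = Re ?D / z" by (simp add: DERIV_imp_deriv)
  then show ?thesis by (subst D) simp
qed

lemma deriv_F_minus: "deriv (F n) (- z) = - deriv (F n) z"
proof -
  have "(F n has_field_derivative deriv (F n) (- z)) (at (- z))"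
    by (rule holomorphic_derivI[OF F_holomorphic open_UNIV]) auto
  then have "((\<lambda>w. F n (- w)) has_field_derivative deriv (F n) (- z) * (- 1)) (at z)"
    by (rule DERIV_chain2) (auto intro!: derivative_eq_intros)
  then have "deriv (F n) z = - deriv (F n) (- z)"
    by (simp add: F_even DERIV_imp_deriv)
  then show ?thesis by simp
qed

text \<open>\<open>R m\<close> contributes \<open>p ^ m\<close>, which with
  \<open>p ^ (n - m)\<close> gives the \<open>p ^ n\<close> needed in \<open>P_at_zero\<close>. The
  result is symmetric in \<open>m\<close> and \<open>n\<close>.\<close>

lemma res_eq:
  assumes "F 0 p = 0" "p + 1 / p = of_real x" "m \<le> n"
  shows "of_real (G n) * res m n p = (p\<^sup>2 - 1) / p * (F 1 p / deriv (F 0) p) * of_real (P q \<alpha> \<beta> m x * P q \<alpha> \<beta> n x)"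
proof -
  have p0: "p \<noteq> 0" using F_zero_nonzero assms by blast
  have "of_real (G n) * res m n p = (p\<^sup>2 - 1) / p / deriv (F 0) p * of_real (P q \<alpha> \<beta> m x)
      * (of_real (G n) * (p ^ m * p ^ (n - m)) * F (n + 1) p)"
    unfolding res_def R_eq_P[OF p0 assms(2)] by (simp add: mult_ac)
  also have "p ^ m * p ^ (n - m) = p ^ n" using assms(3) by (simp flip: power_add)
  also note P_at_zero[OF assms(1,2), of n, symmetric]
  finally show ?thesis by (simp add: mult_ac)
qed

section \<open>The discrete part and the orthogonality relation\<close>

definition Zr :: "real set" where "Zr = {z. 0 < z \<and> z < 1 \<and> psi q \<alpha> \<beta> (-1) z = 0}"

lemma Zr_iff: "z \<in> Zr \<longleftrightarrow> 0 < z \<and> z < 1 \<and> F 0 (of_real z) = 0"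
proof -
  have "psi q \<alpha> \<beta> (-1) z = 0 \<longleftrightarrow> F 0 (of_real z) / of_real z = 0"
    unfolding psi_minus_1[symmetric] by simp
  then show ?thesis by (auto simp: Zr_def)
qed

text \<open>Zeros in the disc are real by \<open>F_zero_real\<close>, nonzero, and occur in pairs
  because \<open>F 0\<close> is even.\<close>

lemma Z_disc: "Z \<inter> ball 0 1 = of_real ` Zr \<union> (\<lambda>x. - of_real x) ` Zr"
proof safe
  fix p assume p: "p \<in> Z" "p \<in> ball 0 1" "p \<notin> (\<lambda>x. - of_real x) ` Zr"
  then have F: "F 0 p = 0" "norm p < 1" by (auto simp: Z_def)
  define x where "x = Re p"
  have px: "p = of_real x" using F_zero_real[OF F] by (simp add: complex_eq_iff x_def)
  have "x \<noteq> 0" using F_zero_nonzero F px by force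
  moreover have "\<not> x < 0"
  proof
    assume "x < 0"
    then have "- x \<in> Zr" using F by (simp add: Zr_iff px F_even)
    then show False using p(3) px by force
  qed
  ultimately have "x \<in> Zr" using F by (simp add: Zr_iff px)
  then show "p \<in> of_real ` Zr" using px by blast
next
  fix x assume x: "x \<in> Zr"
  then have "x\<^sup>2 < 1" by (simp add: Zr_iff power_less_one_iff)
  then have "(of_real x :: complex)\<^sup>2 \<noteq> 1" by (metis less_irrefl of_real_eq_1_iff of_real_power)
  then show "of_real x \<in> Z" "- of_real x \<in> Z" "complex_of_real x \<in> ball 0 1" "- complex_of_real x \<in> ball 0 1"
    using x by (auto simp: Z_def Zr_iff F_even)
qed

lemma finite_Zr: "finite Zr"
proof -
  have "finite (complex_of_real ` Zr)" using finite_Z Z_disc by (metis finite_Int finite_Un)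
  then show ?thesis by (rule finite_imageD) (auto intro: inj_onI)
qed

text \<open>Each \<open>z\<close> collects the residues at \<open>z\<close> and \<open>- z\<close>.
  Their prefactors agree: \<open>(p^2 - 1) / p\<close> and \<open>deriv (F 0) p\<close> are both
  odd, and \<open>F 1\<close> is even.\<close>

lemma sum_over_zeros:
  assumes "m \<le> n"
  shows "(\<Sum>z\<in>Zr. (z\<^sup>2 - 1) / z\<^sup>2 * (psi q \<alpha> \<beta> 0 z / deriv (psi q \<alpha> \<beta> (-1)) z)
         * (P q \<alpha> \<beta> m (z + 1 / z) * P q \<alpha> \<beta> n (z + 1 / z)
            + P q \<alpha> \<beta> m (- (z + 1 / z)) * P q \<alpha> \<beta> n (- (z + 1 / z))))
    = G n * Re (\<Sum>p\<in>Z \<inter> ball 0 1. res m n p)" (is "sum ?f Zr = _")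
proof -
  have term_eq: "complex_of_real (?f z) = of_real (G n) * (res m n (of_real z) + res m n (- of_real z))" if z: "z \<in> Zr" for z
  proof -
    let ?z = "complex_of_real z"
    have F: "F 0 ?z = 0" and z0: "z \<noteq> 0" using z by (auto simp: Zr_iff)
    have Fm: "F 0 (- ?z) = 0" using F by (simp add: F_even)
    have 1: "of_real (G n) * res m n ?z = (?z\<^sup>2 - 1) / ?z * (F 1 ?z / deriv (F 0) ?z)
        * of_real (P q \<alpha> \<beta> m (z + 1 / z) * P q \<alpha> \<beta> n (z + 1 / z))"
      by (rule res_eq[OF F _ assms]) simp
    have 2: "of_real (G n) * res m n (- ?z) = (?z\<^sup>2 - 1) / ?z * (F 1 ?z / deriv (F 0) ?z)
        * of_real (P q \<alpha> \<beta> m (- (z + 1 / z)) * P q \<alpha> \<beta> n (- (z + 1 / z)))"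
      by (subst res_eq[OF Fm _ assms, of "- (z + 1 / z)"]) (simp_all add: F_even deriv_F_minus)
    have "complex_of_real (?f z) = (?z\<^sup>2 - 1) / ?z\<^sup>2 * (F 1 ?z / (deriv (F 0) ?z / ?z))
       * of_real (P q \<alpha> \<beta> m (z + 1 / z) * P q \<alpha> \<beta> n (z + 1 / z)
            + P q \<alpha> \<beta> m (- (z + 1 / z)) * P q \<alpha> \<beta> n (- (z + 1 / z)))"
      unfolding psi_0[symmetric] deriv_psi_at_zero[OF F, symmetric] by simp
    \<comment> \<open>The derivative of \<open>psi\<close> at the zero carries a factor
      \<open>1 / z\<close>, which cancels one power in the denominator.\<close>
    also have "(?z\<^sup>2 - 1) / ?z\<^sup>2 * (F 1 ?z / (deriv (F 0) ?z / ?z)) = (?z\<^sup>2 - 1) / ?z * (F 1 ?z / deriv (F 0) ?z)"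
      using z0 by (simp add: power2_eq_square)
    finally show ?thesis unfolding distrib_left 1 2 of_real_add .
  qed
  have "(\<Sum>p\<in>Z \<inter> ball 0 1. res m n p) = (\<Sum>p\<in>of_real ` Zr. res m n p) + (\<Sum>p\<in>(\<lambda>x. - of_real x) ` Zr. res m n p)"
    unfolding Z_disc
  proof (rule sum.union_disjoint)
    show "of_real ` Zr \<inter> (\<lambda>x. - complex_of_real x) ` Zr = {}"
    proof safe
      fix x y assume xy: "x \<in> Zr" "y \<in> Zr" "complex_of_real x = - complex_of_real y"
      then have "x = - y" by (metis of_real_eq_iff of_real_minus)
      then have False using xy by (simp add: Zr_iff)
      then show "complex_of_real x \<in> {}" ..
    qed
  qed (use finite_Zr in auto)
  also have "\<dots> = (\<Sum>z\<in>Zr. res m n (of_real z)) + (\<Sum>z\<in>Zr. res m n (- of_real z))"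
    by (subst (1 2) sum.reindex) (auto simp: inj_on_def)
  finally have "of_real (G n) * (\<Sum>p\<in>Z \<inter> ball 0 1. res m n p) = (\<Sum>z\<in>Zr. complex_of_real (?f z))"
    by (simp only: term_eq sum.distrib sum_distrib_left[symmetric] cong: sum.cong)
  then have "of_real (G n) * (\<Sum>p\<in>Z \<inter> ball 0 1. res m n p) = complex_of_real (sum ?f Zr)" by (simp only: of_real_sum)
  from arg_cong[OF this, of Re] show ?thesis by simp
qed

text \<open>The residues at the zeros cancel the discrete sum, leaving the contribution
  \<open>G n * G (n + 1)\<close> of the pole at 0.\<close>

lemma orthogonality:
  assumes "m \<le> n"
  shows "(2 / pi) * integral {0..pi} (\<lambda>\<theta>. P q \<alpha> \<beta> m (2 * cos \<theta>) * P q \<alpha> \<beta> n (2 * cos \<theta>)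
         * (sin \<theta>)\<^sup>2 / (cmod (phi21 q \<alpha> \<beta> \<theta>))\<^sup>2)
    + (\<Sum>z\<in>Zr. (z\<^sup>2 - 1) / z\<^sup>2 * (psi q \<alpha> \<beta> 0 z / deriv (psi q \<alpha> \<beta> (-1)) z)
         * (P q \<alpha> \<beta> m (z + 1 / z) * P q \<alpha> \<beta> n (z + 1 / z)
            + P q \<alpha> \<beta> m (- (z + 1 / z)) * P q \<alpha> \<beta> n (- (z + 1 / z))))
    = (if m = n then qpoch \<alpha> q n * qpoch \<alpha> q (n + 1) / (qpoch \<beta> q n * qpoch \<beta> q (n + 1)) else 0)"
  unfolding weighted_integral[OF assms] sum_over_zeros[OF assms] by (simp add: G_eq_qpoch)

end

text \<open>Finiteness is stated along with the identity because a sum over an infinite set would be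
  0 by convention.\<close>

theorem theorem2p14:
  fixes q \<alpha> \<beta> :: real and m n :: nat
  assumes "0 < q" "q < 1" "-1 < \<alpha>" "\<alpha> < 1" "\<beta> < 1"
  shows "finite {z. 0 < z \<and> z < 1 \<and> psi q \<alpha> \<beta> (-1) z = 0} \<and>
    (2 / pi) * integral {0..pi} (\<lambda>\<theta>. P q \<alpha> \<beta> m (2 * cos \<theta>) * P q \<alpha> \<beta> n (2 * cos \<theta>)
         * (sin \<theta>)\<^sup>2 / (cmod (phi21 q \<alpha> \<beta> \<theta>))\<^sup>2)
    + (\<Sum>z\<in>{z. 0 < z \<and> z < 1 \<and> psi q \<alpha> \<beta> (-1) z = 0}.
         (z\<^sup>2 - 1) / z\<^sup>2 * (psi q \<alpha> \<beta> 0 z / deriv (psi q \<alpha> \<beta> (-1)) z)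
         * (P q \<alpha> \<beta> m (z + 1 / z) * P q \<alpha> \<beta> n (z + 1 / z)
            + P q \<alpha> \<beta> m (- (z + 1 / z)) * P q \<alpha> \<beta> n (- (z + 1 / z))))
    = (if m = n then qpoch \<alpha> q n * qpoch \<alpha> q (n + 1) / (qpoch \<beta> q n * qpoch \<beta> q (n + 1))
       else 0)"
proof -
  interpret parameters q \<alpha> \<beta> using assms by unfold_locales auto
  show ?thesis
  proof (cases "m \<le> n")
    case True
    show ?thesis using finite_Zr orthogonality[OF True] unfolding Zr_def by blast
  next
    \<comment> \<open>The relation is symmetric in \<open>m\<close> and \<open>n\<close>, so the
      case already proved applies with the indices exchanged.\<close>
    case False
    then have "n \<le> m" "m \<noteq> n" by auto
    then show ?thesis using finite_Zr orthogonality[OF \<open>n \<le> m\<close>]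
      unfolding Zr_def by (simp only: mult.commute[of "P q \<alpha> \<beta> n _" "P q \<alpha> \<beta> m _"] if_False) simp
  qed
qed

end
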